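(* For a positive integer $k$ put $m(k)=\lfloor \exp(4000(\log\log\log k)^3)\rfloor$. Then the set of odd positive integers $k$ such that $k\in\mathcal C_{m(k)}$ has asymptotic density $1/2$ (i.e. asymptotically all odd positive integers $k$ satisfy $k\in\mathcal C_{m(k)}$).
   Context: $\log x$ denotes $\max\{\ln x,1\}$. For a positive integer $m$, $\mathcal C_m$ is the set of odd positive integers $k$ for which there exist integers $0\le j_1<j_2<\cdots<j_m\le m+k-2$ with $2^{k+m}-1\equiv \sum_{i=1}^m 2^{j_i}\pmod k$. *)

theory Defs
  imports Complex_Main "HOL-Number_Theory.Cong"
begin

text \<open>The paper's logarithm: log x = max(ln x, 1).\<close>
definition plog :: "real \<Rightarrow> real" where
  "plog x = max (ln x) 1"

definition Cset :: "nat \<Rightarrow> nat set" where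
  "Cset m = {k. odd k \<and> 0 < k \<and>
     (\<exists>J. J \<subseteq> {0..m + k - 2} \<and> card J = m \<and>
        [2 ^ (k + m) - 1 = (\<Sum>j\<in>J. 2 ^ j)] (mod (int k)))}"

definition mfun :: "nat \<Rightarrow> nat" where
  "mfun k = nat \<lfloor>exp (4000 * (plog (plog (plog (real k)))) ^ 3)\<rfloor>"

end

theory Submission
  imports
    "HOL-Analysis.Convex"
    "HOL-Library.Nat_Bijection"
    "HOL-Library.FuncSet"
    "HOL-Real_Asymp.Real_Asymp"
    "HOL-Number_Theory.Number_Theory"
    Defs
begin

text \<open>
  Proof idea. It suffices that, for almost all odd k, every residue modulo k is a sum of exactly m
  powers of 2 whose exponents are distinct modulo the order of 2. Put y = (ln ln N)^6 and
  z = 2^(40 y^2), and let n be the z-smooth part of k. Outside a set of density zero: k has no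
  square factor p^2 with p > y; no prime q > y divides p - 1 for two different primes p dividing k
  (a Chebyshev bound for primes 1 modulo q); n is at most 2^(m - 1680); and every prime p > z
  dividing k is good, which means the following. Let L be the y-smooth part of p - 1. Then L is
  tiny, and every residue modulo p is a sum of 1680 distinct powers of 2^L with small exponents.

  That most primes are good comes from averaging over p in (2^(40j), 2^(40(j+1))]: two different
  sums of 40 powers of 2 with well separated exponents differ by a nonzero integer with few prime
  divisors, so such sums fill a set A of at least about p^(4/5) residues, and an elementary
  point-line incidence bound gives that A A' + A + A is everything. Products of powers of 2 are
  again powers of 2, so this consists of sums of 40 * 40 + 40 + 40 = 1680 powers.

  For generic k the groups generated by 2^L modulo the good primes p have pairwise coprime orders,
  also coprime to the totient of n. So the Chinese remainder theorem, applied to the exponents,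
  combines representations chosen separately for each p, while m - 1680 further powers of 2,
  essentially a binary expansion, adjust the residue modulo n.
\<close>

text \<open>The obstacle: one list of \<open>m\<close> exponents must serve all prime factors of
  \<open>k\<close> at once, while the numbers p - 1 for odd primes p share at least the factor 2.
  Passing from 2 to \<open>2 ^ L\<close>, where \<open>L\<close> absorbs all primes up to
  \<open>y\<close>, leaves orders built from primes above \<open>y\<close>, which rarely share a
  factor. As \<open>L\<close> varies with p, goodness must be demanded for every gap
  \<open>G\<close> up to 2^j. Why 40: for p near 2^(40 j), forty blocks of length 2^j yield about p
  sums. Asking for only about 2^(32 j) residues keeps the primes lost to collisions near 2^(36 j),
  negligible against 2^(40 j), while four sets of that size have product near p^(16/5), beyond the
  p^3 that the incidence bound requires. Two facts about m(k) enter: it exceeds every fixed power of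
  ln ln k for large k, which covers the binary length of a typical smooth part of \<open>k\<close>,
  and it is far below the order of \<open>2 ^ L\<close> modulo a large good prime, which leaves room
  for distinct exponents.\<close>

section \<open>Multiples and multiplicities on average\<close>

lemma card_multiples_le:
  fixes d N :: nat
  assumes "d > 0"
  shows "real (card {k\<in>{1..N}. d dvd k}) \<le> N / d"
proof -
  have "{k\<in>{1..N}. d dvd k} \<subseteq> (\<lambda>i. d * i) ` {1..N div d}"
  proof
    fix k assume "k \<in> {k\<in>{1..N}. d dvd k}"
    then obtain i where i: "k = d * i" "1 \<le> k" "k \<le> N" by auto
    have "i \<le> N div d"
      using i(1,3) assms by (metis div_le_mono nonzero_mult_div_cancel_left less_numeral_extra(3))
    moreover have "1 \<le> i" using i by (cases i) auto
    ultimately show "k \<in> (\<lambda>i. d * i) ` {1..N div d}" using i by auto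
  qed
  then have "card {k\<in>{1..N}. d dvd k} \<le> card {1..N div d}"
    by (meson card_image_le card_mono finite_atLeastAtMost finite_imageI le_trans)
  then have "real (card {k\<in>{1..N}. d dvd k}) \<le> real (N div d)" by simp
  also have "\<dots> \<le> N / d" by (rule of_nat_div_le_of_nat)
  finally show ?thesis .
qed

lemma card_some_divisor_le:
  fixes d :: "'a \<Rightarrow> nat" and N :: nat
  assumes "finite I" "\<And>i. i \<in> I \<Longrightarrow> d i > 0"
  shows "real (card {k\<in>{1..N}. \<exists>i\<in>I. d i dvd k}) \<le> N * (\<Sum>i\<in>I. 1 / d i)"
proof -
  have "{k\<in>{1..N}. \<exists>i\<in>I. d i dvd k} = (\<Union>i\<in>I. {k\<in>{1..N}. d i dvd k})" by auto
  then have "real (card {k\<in>{1..N}. \<exists>i\<in>I. d i dvd k}) \<le> (\<Sum>i\<in>I. real (card {k\<in>{1..N}. d i dvd k}))"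
    using card_UN_le[OF assms(1), of "\<lambda>i. {k\<in>{1..N}. d i dvd k}"]
    by (simp flip: of_nat_sum)
  also have "\<dots> \<le> (\<Sum>i\<in>I. N / d i)"
    by (intro sum_mono card_multiples_le assms)
  finally show ?thesis by (simp add: sum_distrib_left)
qed

lemma sum_inverse_powers_le:
  fixes p :: real
  assumes "p > 1"
  shows "(\<Sum>i=1..n. 1 / p ^ i) \<le> 1 / (p - 1)"
proof -
  have "(\<Sum>i=1..n. 1 / p ^ i) = (1 - 1 / p ^ n) / (p - 1)"
  proof (induction n)
    case (Suc n)
    have "(1 - 1 / p ^ n) / (p - 1) + 1 / p ^ Suc n = (1 - 1 / p ^ Suc n) / (p - 1)"
      using assms by (simp add: divide_simps) (simp add: algebra_simps)
    then show ?case using Suc by simp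
  qed simp
  also have "\<dots> \<le> 1 / (p - 1)" using assms by (intro divide_right_mono) auto
  finally show ?thesis .
qed

text \<open>Counting \<open>k\<close> once for every power \<open>p ^ i\<close> dividing it and
  exchanging the sums leaves a geometric series.\<close>

lemma sum_multiplicity_le:
  fixes p N :: nat
  assumes "prime p"
  shows "(\<Sum>k=1..N. real (multiplicity p k)) \<le> N / (real p - 1)"
proof -
  have p: "p > 1" using assms prime_gt_1_nat by blast
  have mult: "multiplicity p k = card {i\<in>{1..N}. p ^ i dvd k}" if k: "k \<in> {1..N}" for k
  proof -
    have "p ^ multiplicity p k \<le> k"
      using k by (intro dvd_imp_le multiplicity_dvd) auto
    moreover have "multiplicity p k < p ^ multiplicity p k"
      using p power_gt_expt[of p] by auto
    ultimately have "multiplicity p k \<le> N" using k by auto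
    then have "{i\<in>{1..N}. p ^ i dvd k} = {1..multiplicity p k}"
      using k p by (subst power_dvd_iff_le_multiplicity) auto
    then show ?thesis by simp
  qed
  have "(\<Sum>k=1..N. real (multiplicity p k)) = (\<Sum>k=1..N. \<Sum>i=1..N. if p ^ i dvd k then 1 else 0)"
    by (rule sum.cong) (simp_all add: mult sum.If_cases Int_def conj_commute)
  also have "\<dots> = (\<Sum>i=1..N. \<Sum>k=1..N. if p ^ i dvd k then 1 else 0)"
    by (rule sum.swap)
  also have "\<dots> = (\<Sum>i=1..N. real (card {k\<in>{1..N}. p ^ i dvd k}))"
    by (rule sum.cong) (simp_all add: sum.If_cases Int_def conj_commute)
  also have "\<dots> \<le> (\<Sum>i=1..N. N / real (p ^ i))"
    using p by (intro sum_mono card_multiples_le) auto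
  also have "\<dots> = N * (\<Sum>i=1..N. 1 / real p ^ i)" by (simp add: sum_distrib_left)
  also have "\<dots> \<le> N * (1 / (real p - 1))"
    using p by (intro mult_left_mono sum_inverse_powers_le) auto
  finally show ?thesis by simp
qed

lemma prod_distinct_primes_dvd:
  fixes P :: "nat set"
  assumes "finite P" "\<And>p. p \<in> P \<Longrightarrow> prime p \<and> p dvd n"
  shows "\<Prod>P dvd n"
  using assms
proof (induction P rule: finite_induct)
  case (insert p P)
  have "coprime p (\<Prod>P)"
    using insert by (intro prod_coprime_right) (metis insertCI primes_coprime)
  then show ?case using insert by (simp add: divides_mult)
qed simp

subsection \<open>A Chebyshev bound in the progression $1$ modulo $q$\<close>

lemma multiplicity_fact_le:
  assumes "prime (q::nat)"
  shows "multiplicity q (fact n) \<le> n"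
proof -
  have "multiplicity q (fact n :: nat) = (\<Sum>k=1..n. multiplicity q k)"
    unfolding fact_prod using assms
    by (simp add: prime_elem_multiplicity_prod_distrib)
  then have "real (multiplicity q (fact n :: nat)) \<le> n / (real q - 1)"
    using sum_multiplicity_le[OF assms, of n] by simp
  also have "\<dots> \<le> n / 1"
    using prime_ge_2_nat[OF assms] by (intro divide_left_mono) auto
  finally show ?thesis by simp
qed

lemma prod_primes_progression_le:
  fixes q n :: nat
  assumes q: "prime q"
  defines "P \<equiv> {p. prime p \<and> [p = 1] (mod q) \<and> n < p \<and> p \<le> q * n + 1}"
  shows "\<Prod>P \<le> (q * (q + 1)) ^ n"
proof -
  \<comment> \<open>The part \<open>u\<close> of \<open>n!\<close> prime to \<open>q\<close> divides \<open>Q\<close>, because modulo \<open>u\<close> the progression \<open>q j + 1\<close> is \<open>q\<close>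
    times a run of consecutive integers; so \<open>u \<Prod>P\<close> divides \<open>Q\<close>, while \<open>Q \<le> (q + 1)^n n!\<close>.\<close>
  define Q where "Q = (\<Prod>j=1..n. q * j + 1)"
  define v where "v = multiplicity q (fact n)"
  obtain u where u: "fact n = q ^ v * u" "\<not> q dvd u"
    using multiplicity_decompose'[of "fact n" q] q unfolding v_def
    by (metis fact_nonzero not_prime_unit)
  have u0: "u > 0" using u by (metis dvd_0_right gr0I)
  have "coprime q u" using q u by (simp add: prime_imp_coprime)
  then have "coprime (int q) (int u)" by simp
  then obtain b where b: "[int q * b = 1] (mod int u)"
    using cong_solve_coprime_int by blast
  have "[int Q = (\<Prod>j=1..n. int q * (b + int j))] (mod int u)"
    unfolding Q_def of_nat_prod
  proof (rule cong_prod)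
    fix j
    have "[int q * int j + int q * b = int q * int j + 1] (mod int u)"
      using b by (simp add: cong_add_lcancel)
    then show "[int (q * j + 1) = int q * (b + int j)] (mod int u)"
      by (simp add: algebra_simps cong_sym)
  qed
  moreover have "(\<Prod>j=1..n. int q * (b + int j)) = int q ^ n * pochhammer (b + 1) n"
    unfolding pochhammer_prod prod.distrib
    by (simp add: prod.atLeast1_atMost_eq atLeast0LessThan algebra_simps flip: lessThan_atLeast0)
  moreover have "int u dvd int q ^ n * pochhammer (b + 1) n"
  proof -
    have "u dvd fact n" using u by simp
    then have "int u dvd fact n" by (metis of_nat_dvd_iff of_nat_fact)
    then show ?thesis using fact_dvd_pochhammer dvd_mult dvd_trans by blast
  qed
  ultimately have uQ: "u dvd Q"
    by (metis cong_dvd_iff cong_sym dvd_trans int_dvd_int_iff cong_dvd_modulus dvd_refl cong_0_iff cong_trans)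
  have fin: "finite P" unfolding P_def by (rule finite_subset[of _ "{..q * n + 1}"]) auto
  have PQ: "prime p \<and> p dvd Q" if p: "p \<in> P" for p
  proof -
    have p': "prime p" "[p = 1] (mod q)" "n < p" "p \<le> q * n + 1" using p by (auto simp: P_def)
    have "q dvd p - 1"
      using p' by (metis cong_altdef_nat cong_sym prime_ge_1_nat)
    then obtain j where j: "p - 1 = q * j" by auto
    then have pj: "p = q * j + 1" using p'(1) prime_gt_0_nat[of p] by linarith
    have "j \<ge> 1" using pj p'(1) by (cases j) auto
    moreover have "j \<le> n" using pj p'(4) q prime_gt_0_nat[of q] by simp
    ultimately have "p dvd Q" unfolding Q_def pj by (intro dvd_prodI) auto
    then show ?thesis using p' by simp
  qed
  have "\<Prod>P dvd Q" using fin PQ by (rule prod_distinct_primes_dvd)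
  moreover have "coprime u (\<Prod>P)"
  proof (rule prod_coprime_right)
    fix p assume p: "p \<in> P"
    then have "prime p" "n < p" by (auto simp: P_def)
    then have "\<not> p dvd fact n" by (simp add: prime_dvd_fact_iff)
    then have "\<not> p dvd u" using u by (metis dvd_mult)
    then show "coprime u p" using \<open>prime p\<close> by (simp add: prime_imp_coprime coprime_commute)
  qed
  ultimately have "u * \<Prod>P dvd Q" using uQ by (intro divides_mult)
  moreover have "Q > 0" unfolding Q_def by (intro prod_pos) auto
  ultimately have "u * \<Prod>P \<le> Q" by (rule dvd_imp_le)
  also have "Q \<le> (\<Prod>j=1..n. (q + 1) * j)"
    unfolding Q_def by (intro prod_mono) auto
  also have "\<dots> = (q + 1) ^ n * fact n"
    by (simp only: prod.distrib fact_prod prod_constant card_atLeastAtMost) simp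
  also have "\<dots> = u * ((q + 1) ^ n * q ^ v)" using u by simp
  finally have "\<Prod>P \<le> (q + 1) ^ n * q ^ v" using u0 by simp
  also have "\<dots> \<le> (q + 1) ^ n * q ^ n"
    using multiplicity_fact_le[OF q, of n] prime_gt_0_nat[OF q]
    by (intro mult_left_mono power_increasing) (auto simp: v_def)
  finally show ?thesis by (simp only: power_mult_distrib mult.commute)
qed

lemma ln_2_ge_half: "ln 2 \<ge> (1/2 :: real)"
  using ln_le_minus_one[of "1/2 :: real"] by (simp add: ln_div)

lemma harmonic_le: "n \<ge> 1 \<Longrightarrow> (\<Sum>i=1..n. 1 / real i) \<le> 1 + ln n"
proof (induction n rule: nat_induct_at_least)
  case (Suc n)
  have "ln (real n / (n + 1)) \<le> real n / (n + 1) - 1"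
    using Suc by (intro ln_le_minus_one) auto
  then have "1 / real (n + 1) \<le> ln (n + 1) - ln n"
    using Suc by (simp add: ln_div field_simps)
  then show ?case using Suc by simp
qed simp

text \<open>All primes in \<open>P\<close> exceed 2^i, so \<open>(2 ^ i) ^ card P\<close> is at most
  their product, which \<open>prod_primes_progression_le\<close> bounds by q^(3 n) with n about 2^(i
  + 1) / q. Logarithms then bound \<open>card P\<close>; the 24 is 3 * 4 with the 4 of
  \<open>n3\<close>, doubled by ln 2 >= 1/2.\<close>

lemma sum_primes_progression_dyadic_le:
  fixes q i :: nat
  assumes q: "prime q" "q \<ge> 3" and i: "i \<ge> 1"
  defines "P \<equiv> {p. prime p \<and> [p = 1] (mod q) \<and> 2 ^ i < p \<and> p \<le> 2 ^ (i + 1)}"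
  shows "(\<Sum>p\<in>P. 1 / real p) \<le> 24 * ln q / q * (1 / i)"
proof (cases "P = {}")
  case True
  then show ?thesis using q by simp
next
  case False
  then obtain p0 where p0: "prime p0" "[p0 = 1] (mod q)" "p0 \<le> 2 ^ (i + 1)"
    by (auto simp: P_def)
  have "q dvd p0 - 1" using p0 by (metis cong_altdef_nat cong_sym prime_ge_1_nat)
  then have "q \<le> p0 - 1" using p0 prime_gt_1_nat[of p0] by (intro dvd_imp_le) auto
  then have qi: "q < 2 ^ (i + 1)" using p0 prime_gt_1_nat[of p0] by linarith
  \<comment> \<open>At i = 1 the set would have to contain 4, with q = 3. So i >= 2, which
    \<open>n2\<close> uses.\<close>
  have i2: "i \<ge> 2"
  proof (rule ccontr)
    assume "\<not> i \<ge> 2"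
    then have "i = 1" using i by simp
    then have "q = 3" "p0 = 4" using qi q \<open>q \<le> p0 - 1\<close> p0 by auto
    then show False using p0 by (auto simp: prime_nat_iff elim!: allE[of _ 2])
  qed
  \<comment> \<open>Chosen so that the window \<open>n < p\<close>, \<open>p \<le> q * n + 1\<close>
    of the product bound contains all of (2^i, 2^(i + 1)].\<close>
  define n where "n = 2 ^ (i + 1) div q + 1"
  have fin: "finite P" unfolding P_def by (rule finite_subset[of _ "{..2 ^ (i + 1)}"]) auto
  have n1: "2 ^ (i + 1) \<le> q * n"
  proof -
    have "2 ^ (i + 1) = q * (2 ^ (i + 1) div q) + 2 ^ (i + 1) mod q" by simp
    moreover have "2 ^ (i + 1) mod q < q" using q by simp
    ultimately show ?thesis unfolding n_def distrib_left mult_1_right by linarith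
  qed
  have n2: "n \<le> 2 ^ i"
  proof -
    have "2 ^ (i + 1) div q \<le> 2 ^ (i + 1) div (3::nat)" using q by (intro div_le_mono2) auto
    moreover have "(4::nat) \<le> 2 ^ i" using power_increasing[OF i2, of "2::nat"] by simp
    ultimately show ?thesis unfolding n_def by simp
  qed
  have n3: "real n \<le> 4 * 2 ^ i / q"
  proof -
    have "real (2 ^ (i + 1) div q) \<le> 2 ^ (i + 1) / q"
      using of_nat_div_le_of_nat[of "2 ^ (i + 1)" q] by simp
    moreover have "1 \<le> 2 ^ (i + 1) / real q"
      using qi q by (simp add: le_divide_eq) (metis less_imp_le of_nat_le_iff of_nat_mult of_nat_numeral of_nat_power)
    ultimately show ?thesis unfolding n_def by simp
  qed
  let ?P = "{p. prime p \<and> [p = 1] (mod q) \<and> n < p \<and> p \<le> q * n + 1}"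
  have "(2 ^ i) ^ card P \<le> \<Prod>P"
    using prod_mono[of P "\<lambda>_. 2 ^ i" "\<lambda>p. p"] by (simp add: P_def)
  also have "\<Prod>P \<le> \<Prod>?P"
  proof (rule dvd_imp_le[OF prod_dvd_prod_subset])
    show "finite ?P" by (rule finite_subset[of _ "{..q * n + 1}"]) auto
    show "P \<subseteq> ?P" using n1 n2 by (auto simp: P_def)
    show "0 < \<Prod>?P" by (intro prod_pos) (auto simp: prime_gt_0_nat)
  qed
  also have "\<dots> \<le> (q * (q + 1)) ^ n" by (rule prod_primes_progression_le[OF q(1)])
  also have "\<dots> \<le> (q ^ 3) ^ n"
  proof (rule power_mono)
    have "q * (q + 1) \<le> q * (q * q)" using q by (intro mult_left_mono) (auto intro: order.trans[OF _ mult_right_mono[of 3 q q]])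
    then show "q * (q + 1) \<le> q ^ 3" by (simp add: power3_eq_cube mult.assoc)
  qed simp
  finally have "real ((2 ^ i) ^ card P) \<le> real ((q ^ 3) ^ n)" by (rule of_nat_mono)
  then have "real ((2::nat) ^ (i * card P)) \<le> real (q ^ (3 * n))" by (simp add: power_mult)
  then have "ln (2 ^ (i * card P)) \<le> ln (real q ^ (3 * n))"
    using q by (subst ln_le_cancel_iff) auto
  then have "real (i * card P) * ln 2 \<le> real (3 * n) * ln q"
    using q by (simp add: ln_realpow)
  moreover have "real (i * card P) * (1/2) \<le> real (i * card P) * ln 2"
    using ln_2_ge_half by (intro mult_left_mono) auto
  moreover have "real (3 * n) * ln q \<le> (3 * (4 * 2 ^ i / q)) * ln q"
    using n3 q by (intro mult_right_mono) auto
  ultimately have main: "real i * real (card P) \<le> 24 * 2 ^ i / q * ln q" by simp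
  have "(\<Sum>p\<in>P. 1 / real p) \<le> (\<Sum>p\<in>P. 1 / 2 ^ i)"
  proof (rule sum_mono)
    fix p assume "p \<in> P"
    then have "2 ^ i \<le> p" by (simp add: P_def)
    then have "real (2 ^ i) \<le> real p" by (rule of_nat_mono)
    then show "1 / real p \<le> 1 / 2 ^ i" by (intro divide_left_mono mult_pos_pos) (auto intro: less_le_trans[of 0 "2 ^ i"])
  qed
  also have "\<dots> = (real i * real (card P)) / (i * 2 ^ i)" using i by simp
  also have "\<dots> \<le> (24 * 2 ^ i / q * ln q) / (i * 2 ^ i)"
    using main by (intro divide_right_mono) auto
  also have "\<dots> = 24 * ln q / q * (1 / i)" by simp
  finally show ?thesis .
qed

lemma dyadic_cover:
  fixes p :: nat
  assumes "1 < p" "p \<le> 2 ^ J"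
  shows "\<exists>i<J. 2 ^ i < p \<and> p \<le> 2 ^ (i + 1)"
  using assms(2)
proof (induction J)
  case (Suc J)
  show ?case
  proof (cases "p \<le> 2 ^ J")
    case True
    then show ?thesis using Suc.IH less_SucI by blast
  next
    case False
    then show ?thesis using Suc.prems by (intro exI[of _ J]) auto
  qed
qed (use assms in simp)

lemma sum_UN_le:
  fixes f :: "'a \<Rightarrow> real"
  assumes "finite I" "\<And>i. i \<in> I \<Longrightarrow> finite (A i)" "\<And>x. f x \<ge> 0"
  shows "sum f (\<Union>i\<in>I. A i) \<le> (\<Sum>i\<in>I. sum f (A i))"
  using assms
proof (induction I rule: finite_induct)
  case (insert i I)
  have "sum f (A i \<union> (\<Union>i\<in>I. A i)) \<le> sum f (A i) + sum f (\<Union>i\<in>I. A i)"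
    using insert by (subst sum_Un) (auto intro!: sum_nonneg)
  then show ?case using insert by simp
qed simp

text \<open>Dyadic summation turns the terms 1 / i into a harmonic sum. \<open>J\<close> bounds log2
  N, so \<open>ln J\<close> is of the size of ln ln N; the factor ln q, a loss against the expected
  order, is harmless when squares of these sums are summed over q.\<close>

lemma sum_primes_progression_le:
  fixes q N J :: nat
  assumes q: "prime q" "q \<ge> 3" and N: "N \<le> 2 ^ J" and J: "J \<ge> 1"
  shows "(\<Sum>p | prime p \<and> [p = 1] (mod q) \<and> p \<le> N. 1 / real p) \<le> 24 * ln q / q * (1 + ln J)"
proof -
  define P where "P i = {p. prime p \<and> [p = 1] (mod q) \<and> 2 ^ i < p \<and> p \<le> 2 ^ (i + 1)}" for i :: nat
  have fin: "finite (P i)" for i unfolding P_def by (rule finite_subset[of _ "{..2 ^ (i + 1)}"]) auto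
  have "{p. prime p \<and> [p = 1] (mod q) \<and> p \<le> N} \<subseteq> (\<Union>i\<in>{1..J}. P i)"
  proof
    fix p assume "p \<in> {p. prime p \<and> [p = 1] (mod q) \<and> p \<le> N}"
    then have p: "prime p" "[p = 1] (mod q)" "p \<le> N" by auto
    then obtain i where i: "i < J" "2 ^ i < p" "p \<le> 2 ^ (i + 1)"
      using dyadic_cover[of p J] N prime_gt_1_nat[of p] by (meson le_trans)
    \<comment> \<open>The harmonic sum starts at 1, so the interval (1, 2] must drop out: its only
      prime is 2, and q >= 3.\<close>
    have "i \<noteq> 0"
    proof
      assume "i = 0"
      then have "p = 2" using i by simp
      then have "[2 = 1] (mod q)" using p by simp
      then have "q dvd 1" by (simp add: cong_altdef_nat)
      then show False using q by simp
    qed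
    then show "p \<in> (\<Union>i\<in>{1..J}. P i)" using p i by (auto simp: P_def)
  qed
  then have "(\<Sum>p | prime p \<and> [p = 1] (mod q) \<and> p \<le> N. 1 / real p) \<le> (\<Sum>p\<in>(\<Union>i\<in>{1..J}. P i). 1 / real p)"
    using fin by (intro sum_mono2) auto
  also have "\<dots> \<le> (\<Sum>i=1..J. \<Sum>p\<in>P i. 1 / real p)"
    using fin by (intro sum_UN_le) auto
  also have "\<dots> \<le> (\<Sum>i=1..J. 24 * ln q / q * (1 / i))"
    unfolding P_def by (intro sum_mono sum_primes_progression_dyadic_le q) auto
  also have "\<dots> = 24 * ln q / q * (\<Sum>i=1..J. 1 / real i)" by (simp add: sum_distrib_left)
  also have "\<dots> \<le> 24 * ln q / q * (1 + ln J)"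
    using q by (intro mult_left_mono harmonic_le J) auto
  finally show ?thesis .
qed

subsection \<open>Incidences between points and lines over a prime field\<close>

lemma card_common_points_of_two_lines_le:
  fixes p :: nat and a c a' c' :: int
  assumes p: "prime p" and range: "a \<in> {0..<int p}" "c \<in> {0..<int p}" "a' \<in> {0..<int p}" "c' \<in> {0..<int p}"
    and ne: "(a, c) \<noteq> (a', c')"
  shows "card {(x, w). (x, w) \<in> {0..<int p} \<times> {0..<int p} \<and> [a * x + c = w] (mod int p) \<and> [a' * x + c' = w] (mod int p)} \<le> 1"
    (is "card ?S \<le> 1")
proof -
  have unique: "u = v" if uv: "u \<in> ?S" "v \<in> ?S" for u v
  proof -
    obtain x w y z where u: "u = (x, w)" and v: "v = (y, z)" by fastforce
    have x: "x \<in> {0..<int p}" "w \<in> {0..<int p}" "[a * x + c = w] (mod int p)" "[a' * x + c' = w] (mod int p)"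
      and y: "y \<in> {0..<int p}" "z \<in> {0..<int p}" "[a * y + c = z] (mod int p)" "[a' * y + c' = z] (mod int p)"
      using uv by (auto simp: u v)
    have x': "[a * x + c = a' * x + c'] (mod int p)" and y': "[a * y + c = a' * y + c'] (mod int p)"
      using x y by (meson cong_sym cong_trans)+
    have "a \<noteq> a'"
    proof
      assume "a = a'"
      then have "[c = c'] (mod int p)" using x' by (simp add: cong_add_lcancel)
      then have "c = c'" using range by (meson atLeastLessThan_iff cong_less_imp_eq_int)
      with \<open>a = a'\<close> show False using ne by blast
    qed
    have "[(a - a') * x = c' - c] (mod int p)" "[(a - a') * y = c' - c] (mod int p)"
      using x' y' by (simp_all add: cong_iff_dvd_diff algebra_simps)
    then have "[(a - a') * x = (a - a') * y] (mod int p)" by (meson cong_sym cong_trans)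
    moreover have "\<not> int p dvd a - a'"
    proof
      assume "int p dvd a - a'"
      then have "[a = a'] (mod int p)" by (simp add: cong_iff_dvd_diff)
      then show False using range \<open>a \<noteq> a'\<close> by (meson atLeastLessThan_iff cong_less_imp_eq_int)
    qed
    then have "coprime (a - a') (int p)"
      using p prime_imp_coprime[of "int p" "a - a'"] by (simp add: coprime_commute)
    ultimately have "[x = y] (mod int p)" by (simp add: cong_mult_lcancel)
    then have "x = y" using x(1) y(1) by (meson atLeastLessThan_iff cong_less_imp_eq_int)
    with x(3) y(3) have "[w = z] (mod int p)" by (meson cong_sym cong_trans)
    then have "w = z" using x(2) y(2) by (meson atLeastLessThan_iff cong_less_imp_eq_int)
    with \<open>x = y\<close> show ?thesis by (simp add: u v)
  qed
  have "finite ?S" by (rule finite_subset[of _ "{0..<int p} \<times> {0..<int p}"]) auto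
  then show ?thesis unfolding One_nat_def by (subst card_le_Suc0_iff_eq) (assumption, intro ballI unique)
qed

lemma card_points_on_line:
  fixes p :: nat and a c :: int
  assumes p: "p > 0"
  shows "card {(x, w). (x, w) \<in> {0..<int p} \<times> {0..<int p} \<and> [a * x + c = w] (mod int p)} = p"
proof -
  have "{(x, w). (x, w) \<in> {0..<int p} \<times> {0..<int p} \<and> [a * x + c = w] (mod int p)}
      = (\<lambda>x. (x, (a * x + c) mod int p)) ` {0..<int p}"
  proof (intro equalityI subsetI)
    fix u assume "u \<in> {(x, w). (x, w) \<in> {0..<int p} \<times> {0..<int p} \<and> [a * x + c = w] (mod int p)}"
    then obtain x w where u: "u = (x, w)" "x \<in> {0..<int p}" "w \<in> {0..<int p}" "[a * x + c = w] (mod int p)" by auto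
    have "[(a * x + c) mod int p = w] (mod int p)" using u(4) by simp
    then have "(a * x + c) mod int p = w"
      using u(3) p by (intro cong_less_imp_eq_int) auto
    then show "u \<in> (\<lambda>x. (x, (a * x + c) mod int p)) ` {0..<int p}" using u by auto
  qed (use p in auto)
  then show ?thesis by (simp add: card_image inj_on_def)
qed

lemma sum_product_solvable:
  fixes p :: nat and A B C D :: "int set" and r :: int
  assumes p: "prime p"
    and sub: "A \<subseteq> {0..<int p}" "B \<subseteq> {0..<int p}" "C \<subseteq> {0..<int p}" "D \<subseteq> {0..<int p}"
    and large: "card A * card B * card C * card D > p ^ 3"
  shows "\<exists>a\<in>A. \<exists>b\<in>B. \<exists>c\<in>C. \<exists>d\<in>D. [a * b + c + d = r] (mod int p)"
proof (rule ccontr)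
  \<comment> \<open>A solution is an incidence between a point \<open>(b, r - d)\<close> and a line \<open>w = a x + c\<close>. The second moment of
    the number \<open>cnt u\<close> of lines through \<open>u\<close> shows that few points meet no line.\<close>
  assume none: "\<not> ?thesis"
  define U where "U = {0..<int p} \<times> {0..<int p}"
  define L where "L = A \<times> C"
  define on where "on l u = [fst l * fst u + snd l = snd u] (mod int p)" for l u :: "int \<times> int"
  define cnt where "cnt u = (\<Sum>l\<in>L. of_bool (on l u) :: int)" for u
  define K where "K = int (card L)"
  have p0: "p > 0" using p prime_gt_0_nat by blast
  have fin: "finite A" "finite B" "finite C" "finite D" using sub finite_subset by blast+
  have finL: "finite L" and finU: "finite U" using fin by (auto simp: L_def U_def)
  have on1: "(\<Sum>u\<in>U. of_bool (on l u) :: int) = p" for l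
  proof -
    have "(\<Sum>u\<in>U. of_bool (on l u) :: int) = card {u\<in>U. on l u}"
      using finU by (simp add: of_bool_def sum.If_cases Int_def)
    also have "{u\<in>U. on l u} = {(x, w). (x, w) \<in> {0..<int p} \<times> {0..<int p} \<and> [fst l * x + snd l = w] (mod int p)}"
      by (auto simp: U_def on_def)
    finally show ?thesis using card_points_on_line[OF p0] by simp
  qed
  have on2: "(\<Sum>u\<in>U. of_bool (on l u) * of_bool (on l' u) :: int) \<le> (if l = l' then int p else 0) + 1"
    if l: "l \<in> L" "l' \<in> L" for l l'
  proof (cases "l = l'")
    case True
    then have "(\<Sum>u\<in>U. of_bool (on l u) * of_bool (on l' u) :: int) = (\<Sum>u\<in>U. of_bool (on l u))"
      by (intro sum.cong) auto
    then show ?thesis using on1[of l] True by simp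
  next
    case False
    have "(\<Sum>u\<in>U. of_bool (on l u) * of_bool (on l' u) :: int) = card {u\<in>U. on l u \<and> on l' u}"
      unfolding of_bool_conj[symmetric] using finU by (simp add: of_bool_def sum.If_cases Int_def)
    also have "{u\<in>U. on l u \<and> on l' u} = {(x, w). (x, w) \<in> {0..<int p} \<times> {0..<int p} \<and>
        [fst l * x + snd l = w] (mod int p) \<and> [fst l' * x + snd l' = w] (mod int p)}"
      by (auto simp: U_def on_def)
    finally have eq: "(\<Sum>u\<in>U. of_bool (on l u) * of_bool (on l' u) :: int) = int (card {(x, w). (x, w) \<in> {0..<int p} \<times> {0..<int p} \<and>
        [fst l * x + snd l = w] (mod int p) \<and> [fst l' * x + snd l' = w] (mod int p)})" .
    have "card {(x, w). (x, w) \<in> {0..<int p} \<times> {0..<int p} \<and>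
        [fst l * x + snd l = w] (mod int p) \<and> [fst l' * x + snd l' = w] (mod int p)} \<le> 1"
    proof (rule card_common_points_of_two_lines_le[OF p])
      show "fst l \<in> {0..<int p}" "snd l \<in> {0..<int p}" "fst l' \<in> {0..<int p}" "snd l' \<in> {0..<int p}"
        using l sub unfolding L_def by (metis mem_Times_iff subsetD)+
      show "(fst l, snd l) \<noteq> (fst l', snd l')" using False by (simp add: prod_eq_iff)
    qed
    then show ?thesis unfolding eq using False by simp
  qed
  have S1: "(\<Sum>u\<in>U. cnt u) = p * K"
    unfolding cnt_def by (subst sum.swap) (simp add: on1 K_def)
  have "(\<Sum>u\<in>U. (cnt u)\<^sup>2) = (\<Sum>u\<in>U. \<Sum>l\<in>L. \<Sum>l'\<in>L. of_bool (on l u) * of_bool (on l' u))"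
    unfolding cnt_def power2_eq_square sum_product by simp
  also have "\<dots> = (\<Sum>l\<in>L. \<Sum>u\<in>U. \<Sum>l'\<in>L. of_bool (on l u) * of_bool (on l' u))"
    by (rule sum.swap)
  also have "\<dots> = (\<Sum>l\<in>L. \<Sum>l'\<in>L. \<Sum>u\<in>U. of_bool (on l u) * of_bool (on l' u))"
    by (intro sum.cong refl sum.swap)
  also have "\<dots> \<le> (\<Sum>l\<in>L. \<Sum>l'\<in>L. (if l = l' then int p else 0) + 1)"
    by (intro sum_mono on2)
  also have "\<dots> = p * K + K\<^sup>2"
    using finL by (simp add: sum.distrib sum.delta' K_def power2_eq_square algebra_simps)
  finally have S2: "(\<Sum>u\<in>U. (cnt u)\<^sup>2) \<le> p * K + K\<^sup>2" .
  \<comment> \<open>The mean of \<open>cnt\<close> over the P^2 points is K / P, so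
    \<open>P * cnt u - K\<close> is the deviation from the mean, cleared of its denominator.\<close>
  define P where "P = int p"
  have sq: "(P * x - K)\<^sup>2 = P\<^sup>2 * x\<^sup>2 - 2 * P * K * x + K\<^sup>2" for x
    by (simp add: power2_diff power_mult_distrib mult_ac)
  have "(\<Sum>u\<in>U. (P * cnt u - K)\<^sup>2) = P\<^sup>2 * (\<Sum>u\<in>U. (cnt u)\<^sup>2) - 2 * P * K * (\<Sum>u\<in>U. cnt u) + (\<Sum>u\<in>U. K\<^sup>2)"
    by (simp only: sq sum.distrib sum_subtractf sum_distrib_left)
  also have "(\<Sum>u\<in>U. K\<^sup>2) = P\<^sup>2 * K\<^sup>2" by (simp add: U_def P_def power2_eq_square)
  also have "P\<^sup>2 * (\<Sum>u\<in>U. (cnt u)\<^sup>2) - 2 * P * K * (\<Sum>u\<in>U. cnt u) + P\<^sup>2 * K\<^sup>2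
      \<le> P\<^sup>2 * (P * K + K\<^sup>2) - 2 * P * K * (P * K) + P\<^sup>2 * K\<^sup>2"
    using mult_left_mono[OF S2, of "P ^ 2"] by (simp add: S1 P_def)
  also have "\<dots> = P ^ 3 * K" by (simp add: power2_eq_square power3_eq_cube algebra_simps)
  finally have upper: "(\<Sum>u\<in>U. (P * cnt u - K)\<^sup>2) \<le> P ^ 3 * K" .
  \<comment> \<open>A line of \<open>L\<close> through \<open>g (b, d)\<close> would be a solution
    involving b and d. Without solutions, each of these card B * card D points contributes a full
    K^2 to the second moment.\<close>
  define g where "g v = (fst v, (r - snd v) mod int p)" for v :: "int \<times> int"
  have inj: "inj_on g (B \<times> D)"
  proof (rule inj_onI)
    fix v v' assume v: "v \<in> B \<times> D" "v' \<in> B \<times> D" "g v = g v'"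
    from v(3) have "(r - snd v) mod int p = (r - snd v') mod int p" by (simp add: g_def)
    then have "[r - snd v = r - snd v'] (mod int p)" by (simp only: cong_def)
    from cong_diff[OF cong_refl[of r] this] have "[snd v = snd v'] (mod int p)" by simp
    moreover have "snd v \<in> {0..<int p}" "snd v' \<in> {0..<int p}" using v sub by auto
    ultimately have snd: "snd v = snd v'" by (meson atLeastLessThan_iff cong_less_imp_eq_int)
    have "fst v = fst v'" using v(3) by (simp add: g_def)
    then show "v = v'" using snd by (simp add: prod_eq_iff)
  qed
  have "cnt u = 0" if "u \<in> g ` (B \<times> D)" for u
  proof -
    obtain b d where bd: "b \<in> B" "d \<in> D" "u = (b, (r - d) mod int p)" using \<open>u \<in> g ` (B \<times> D)\<close> by (auto simp: g_def)
    have "\<not> on l u" if l: "l \<in> L" for l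
    proof
      assume "on l u"
      then have "[fst l * b + snd l = r - d] (mod int p)" by (simp add: on_def bd cong_def)
      then have "[fst l * b + snd l + d = r] (mod int p)" by (simp add: cong_iff_dvd_diff algebra_simps)
      then show False using none bd l by (auto simp: L_def)
    qed
    then show ?thesis by (simp add: cnt_def)
  qed
  then have "(\<Sum>u\<in>g ` (B \<times> D). (P * cnt u - K)\<^sup>2) = (\<Sum>u\<in>g ` (B \<times> D). K\<^sup>2)"
    by (intro sum.cong) auto
  then have "int (card B * card D) * K\<^sup>2 = (\<Sum>u\<in>g ` (B \<times> D). (P * cnt u - K)\<^sup>2)"
    using inj by (simp add: card_image card_cartesian_product)
  also have "\<dots> \<le> (\<Sum>u\<in>U. (P * cnt u - K)\<^sup>2)"
  proof (rule sum_mono2[OF finU])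
    show "g ` (B \<times> D) \<subseteq> U"
    proof
      fix u assume "u \<in> g ` (B \<times> D)"
      then obtain b d where "b \<in> B" "d \<in> D" "u = g (b, d)" by auto
      moreover from this have "b \<in> {0..<int p}" using sub by blast
      ultimately show "u \<in> U" using p0 by (simp add: U_def g_def)
    qed
  qed simp
  finally have "(int (card B * card D) * K) * K \<le> P ^ 3 * K" using upper by (simp add: power2_eq_square)
  moreover have "K > 0" using large by (cases "card A = 0 \<or> card C = 0") (auto simp: K_def L_def card_cartesian_product)
  ultimately have "int (card B * card D) * K \<le> P ^ 3" by simp
  then have "int (card A * card B * card C * card D) \<le> int (p ^ 3)"
    by (simp add: K_def L_def P_def card_cartesian_product mult_ac)
  then show False using large by linarith
qed

subsection \<open>Residues of sums of well-separated powers of two\<close>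

text \<open>Cauchy-Schwarz for the fibre sizes of \<open>f\<close>: they add up to
  \<open>card X\<close>, and their squares count the colliding pairs.\<close>

lemma card_squared_le_collisions:
  assumes fin: "finite X"
  shows "(card X)\<^sup>2 \<le> card (f ` X) * card {(x, y). x \<in> X \<and> y \<in> X \<and> f x = f y}"
proof -
  define n where "n v = card {x\<in>X. f x = v}" for v
  have "card X = card (\<Union>v\<in>f ` X. {x\<in>X. f x = v})" by (rule arg_cong[of _ _ card]) auto
  also have "\<dots> = (\<Sum>v\<in>f ` X. n v)"
    unfolding n_def using fin by (subst card_UN_disjoint) auto
  finally have X: "card X = (\<Sum>v\<in>f ` X. n v)" .
  have "card {(x, y). x \<in> X \<and> y \<in> X \<and> f x = f y} = card (\<Union>v\<in>f ` X. {x\<in>X. f x = v} \<times> {x\<in>X. f x = v})"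
    by (rule arg_cong[of _ _ card]) auto
  also have "\<dots> = (\<Sum>v\<in>f ` X. (n v)\<^sup>2)"
    unfolding n_def using fin by (subst card_UN_disjoint) (auto simp: card_cartesian_product power2_eq_square)
  finally have coll: "card {(x, y). x \<in> X \<and> y \<in> X \<and> f x = f y} = (\<Sum>v\<in>f ` X. (n v)\<^sup>2)" .
  have "real ((\<Sum>v\<in>f ` X. n v)\<^sup>2) \<le> real (card (f ` X) * (\<Sum>v\<in>f ` X. (n v)\<^sup>2))"
    using sum_squared_le_sum_of_squares[of "\<lambda>v. real (n v)" "f ` X"] fin by (simp add: mult.commute)
  then show ?thesis unfolding X coll by (simp only: of_nat_le_iff)
qed

lemma card_prime_divisors_le:
  fixes n :: nat
  assumes "finite P" "\<And>p. p \<in> P \<Longrightarrow> prime p \<and> p dvd n" "n > 0" "n < 2 ^ b"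
  shows "card P \<le> b"
proof -
  have dvd: "\<Prod>P dvd n" using assms(1,2) by (rule prod_distinct_primes_dvd)
  have "2 ^ card P \<le> \<Prod>P"
    using prod_mono[of P "\<lambda>_. 2" "\<lambda>p. p"] assms(2) by (auto simp: prime_ge_2_nat)
  also have "\<Prod>P \<le> n" using dvd assms(3) by (rule dvd_imp_le)
  also have "n < 2 ^ b" by fact
  finally show ?thesis by (simp add: power_strict_increasing_iff less_imp_le)
qed

text \<open>One exponent from each of 40 consecutive intervals of length \<open>T\<close>.\<close>

definition blocks :: "nat \<Rightarrow> nat set set" where
  "blocks T = (\<lambda>a. (\<lambda>i. a i + i * T) ` {..<40}) ` (PiE {..<40} (\<lambda>_. {..<T}))"

text \<open>The base is \<open>2 ^ G\<close> because \<open>G\<close> will be the smooth part of p -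
  1, or that number times a second scale.\<close>

definition pow2_sum :: "nat \<Rightarrow> nat set \<Rightarrow> nat" where
  "pow2_sum G E = (\<Sum>e\<in>E. 2 ^ (G * e))"

lemma block_index_unique:
  fixes a b i k T :: nat
  assumes "a < T" "b < T" "a + i * T = b + k * T"
  shows "i = k" "a = b"
proof -
  have "(a + i * T) div T = i" "(b + k * T) div T = k" using assms(1,2) by auto
  then show "i = k" using assms(3) by simp
  then show "a = b" using assms by simp
qed

lemma finite_blocks: "finite (blocks T)"
  unfolding blocks_def by (rule finite_imageI[OF finite_PiE]) auto

lemma card_blocks: "card (blocks T) = T ^ 40"
proof -
  have "inj_on (\<lambda>a. (\<lambda>i. a i + i * T) ` {..<40}) (PiE {..<40} (\<lambda>_. {..<T}))"
  proof (rule inj_onI)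
    fix a b assume a: "a \<in> PiE {..<40} (\<lambda>_. {..<T})" and b: "b \<in> PiE {..<40} (\<lambda>_. {..<T})"
      and eq: "(\<lambda>i. a i + i * T) ` {..<40} = (\<lambda>i. b i + i * T) ` {..<(40::nat)}"
    show "a = b"
    proof (rule PiE_ext[OF a b])
      fix i :: nat assume i: "i \<in> {..<40}"
      then have "a i + i * T \<in> (\<lambda>i. b i + i * T) ` {..<40}" using eq by blast
      then obtain k where k: "k < 40" "a i + i * T = b k + k * T" by auto
      then show "a i = b i" using block_index_unique[of "a i" T "b k" i k] a b i by fastforce
    qed
  qed
  then show ?thesis unfolding blocks_def by (simp add: card_image card_PiE)
qed

lemma blocksD:
  assumes "E \<in> blocks T"
  shows "finite E" "card E = 40" "E \<subseteq> {..<40 * T}"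
proof -
  obtain a where a: "a \<in> PiE {..<40} (\<lambda>_. {..<T})" and E: "E = (\<lambda>i. a i + i * T) ` {..<40}"
    using assms by (auto simp: blocks_def)
  show "finite E" unfolding E by simp
  have "inj_on (\<lambda>i. a i + i * T) {..<40}"
  proof (rule inj_onI)
    fix i k :: nat assume "i \<in> {..<40}" "k \<in> {..<40}" "a i + i * T = a k + k * T"
    moreover from this have "a i < T" "a k < T" using a by (simp_all add: PiE_iff)
    ultimately show "i = k" using block_index_unique(1) by metis
  qed
  then show "card E = 40" unfolding E by (simp add: card_image)
  have "a i + i * T < 40 * T" if "i < 40" for i
  proof -
    have "a i < T" using a that by (auto simp: PiE_iff)
    then have "a i + i * T < (i + 1) * T" by simp
    also have "\<dots> \<le> 40 * T" using that by (intro mult_right_mono) auto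
    finally show ?thesis .
  qed
  then show "E \<subseteq> {..<40 * T}" unfolding E by auto
qed

text \<open>Through \<open>set_encode\<close>, injectivity becomes the uniqueness of binary
  expansions.\<close>

lemma pow2_sum_eq_set_encode: "G > 0 \<Longrightarrow> pow2_sum G E = set_encode ((*) G ` E)"
  unfolding pow2_sum_def set_encode_def by (subst sum.reindex) (auto simp: inj_on_def)

lemma pow2_sum_inj:
  assumes "G > 0" "finite E" "finite F" "pow2_sum G E = pow2_sum G F"
  shows "E = F"
proof -
  have "(*) G ` E = (*) G ` F" using assms by (simp add: pow2_sum_eq_set_encode set_encode_eq)
  moreover have "inj ((*) G)" using assms(1) by (simp add: inj_on_def)
  ultimately show ?thesis by (simp add: inj_image_eq_iff)
qed

lemma pow2_sum_less:
  assumes "G > 0" "E \<subseteq> {..<n}"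
  shows "pow2_sum G E < 2 ^ (G * n)"
proof -
  have "pow2_sum G E = (\<Sum>e\<in>(*) G ` E. 2 ^ e)"
    using assms unfolding pow2_sum_def by (subst sum.reindex) (auto simp: inj_on_def)
  also have "\<dots> \<le> (\<Sum>e<G * n. 2 ^ e)"
    using assms by (intro sum_mono2) auto
  also have "\<dots> = 2 ^ (G * n) - 1" by (metis atLeast0LessThan sum_power2)
  also have "\<dots> < 2 ^ (G * n)" by simp
  finally show ?thesis .
qed

definition block_residues :: "nat \<Rightarrow> nat \<Rightarrow> nat \<Rightarrow> nat set" where
  "block_residues p j G = (\<lambda>E. pow2_sum G E mod p) ` blocks (2 ^ j)"

lemma card_small_block_residues_le:
  assumes G: "G > 0" and P: "finite P" "\<And>p. p \<in> P \<Longrightarrow> prime p"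
    and small: "\<And>p. p \<in> P \<Longrightarrow> 2 * card (block_residues p j G) < 2 ^ (32 * j)"
  shows "card P \<le> 40 * G * 2 ^ (33 * j)"
proof -
  \<comment> \<open>Few residues force many collisions modulo \<open>p\<close>, but each pair of sums collides for few \<open>p\<close>.\<close>
  define X where "X = blocks (2 ^ j)"
  define coll where "coll p = {(E, F). E \<in> X \<and> F \<in> X \<and> E \<noteq> F \<and> pow2_sum G E mod p = pow2_sum G F mod p}" for p
  have finX: "finite X" and cX: "card X = 2 ^ (40 * j)"
    by (simp_all add: X_def finite_blocks card_blocks mult.commute flip: power_mult)
  have fincoll: "finite (coll p)" for p
    by (rule finite_subset[of _ "X \<times> X"]) (auto simp: coll_def finX)
  \<comment> \<open>The 2^(40 j) sums take fewer than 2^(32 j) / 2 values, so at least 2 * 2^(48 j)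
    ordered pairs collide; discarding the 2^(40 j) diagonal pairs leaves at least half of
    that.\<close>
  have many: "2 ^ (48 * j) \<le> card (coll p)" if p: "p \<in> P" for p
  proof -
    have "{(E, F). E \<in> X \<and> F \<in> X \<and> pow2_sum G E mod p = pow2_sum G F mod p} = coll p \<union> (\<lambda>E. (E, E)) ` X"
      by (auto simp: coll_def)
    then have "card {(E, F). E \<in> X \<and> F \<in> X \<and> pow2_sum G E mod p = pow2_sum G F mod p} \<le> card (coll p) + card ((\<lambda>E. (E, E)) ` X)"
      by (simp add: card_Un_le)
    also have "card ((\<lambda>E. (E, E)) ` X) \<le> card X" by (rule card_image_le[OF finX])
    finally have "card {(E, F). E \<in> X \<and> F \<in> X \<and> pow2_sum G E mod p = pow2_sum G F mod p} \<le> card (coll p) + 2 ^ (40 * j)"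
      by (simp add: cX)
    then have "(2 ^ (40 * j))\<^sup>2 \<le> card (block_residues p j G) * (card (coll p) + 2 ^ (40 * j))"
      using card_squared_le_collisions[OF finX, of "\<lambda>E. pow2_sum G E mod p"]
      unfolding block_residues_def X_def[symmetric] cX
      by (meson le_trans mult_le_mono2)
    then have "2 ^ (32 * j) * (2 * 2 ^ (48 * j)) \<le> (2 * card (block_residues p j G)) * (card (coll p) + 2 ^ (40 * j))"
      by (simp flip: power_add power_mult)
    also have "\<dots> \<le> 2 ^ (32 * j) * (card (coll p) + 2 ^ (40 * j))"
      using small[OF p] by (intro mult_right_mono) auto
    finally have "2 * 2 ^ (48 * j) \<le> card (coll p) + 2 ^ (40 * j)" by simp
    moreover have "(2::nat) ^ (40 * j) \<le> 2 ^ (48 * j)" by (intro power_increasing) auto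
    ultimately show ?thesis by linarith
  qed
  have few: "card {p\<in>P. (E, F) \<in> coll p} \<le> G * (40 * 2 ^ j)" if EF: "E \<in> X" "F \<in> X" for E F
  proof (cases "E = F")
    case False
    define d where "d = nat \<bar>int (pow2_sum G E) - int (pow2_sum G F)\<bar>"
    have E: "finite E" "E \<subseteq> {..<40 * 2 ^ j}" and F: "finite F" "F \<subseteq> {..<40 * 2 ^ j}"
      using EF blocksD unfolding X_def by blast+
    have "pow2_sum G E \<noteq> pow2_sum G F" using pow2_sum_inj[OF G] E F False by blast
    then have "d > 0" by (simp add: d_def)
    have "d < 2 ^ (G * (40 * 2 ^ j))"
    proof -
      have "int (pow2_sum G E) < int (2 ^ (G * (40 * 2 ^ j)))" "int (pow2_sum G F) < int (2 ^ (G * (40 * 2 ^ j)))"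
        using pow2_sum_less[OF G E(2)] pow2_sum_less[OF G F(2)] by (simp_all only: of_nat_less_iff)
      then have "\<bar>int (pow2_sum G E) - int (pow2_sum G F)\<bar> < int (2 ^ (G * (40 * 2 ^ j)))"
        by linarith
      then show ?thesis unfolding d_def by linarith
    qed
    moreover have "prime p \<and> p dvd d" if "p \<in> {p\<in>P. (E, F) \<in> coll p}" for p
    proof -
      have "[int (pow2_sum G E) = int (pow2_sum G F)] (mod int p)"
        using that by (simp add: coll_def cong_int_iff) (simp add: cong_def)
      then have "int p dvd int (pow2_sum G E) - int (pow2_sum G F)" by (simp add: cong_iff_dvd_diff)
      then show ?thesis using P(2) that by (simp add: d_def flip: int_dvd_int_iff)
    qed
    ultimately show ?thesis using P(1) \<open>d > 0\<close> by (intro card_prime_divisors_le) auto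
  qed (simp add: coll_def)
  \<comment> \<open>Double counting of primes together with colliding pairs: the left side is at
    most 2^(80 j) * 40 G 2^j, whence the exponent 33 = 80 + 1 - 48.\<close>
  have "card P * 2 ^ (48 * j) \<le> (\<Sum>p\<in>P. card (coll p))"
    using sum_mono[of P "\<lambda>_. 2 ^ (48 * j)" "\<lambda>p. card (coll p)"] many by simp
  also have "\<dots> = (\<Sum>p\<in>P. \<Sum>v\<in>X \<times> X. if v \<in> coll p then 1 else 0)"
  proof (rule sum.cong)
    fix p
    have "coll p = {v\<in>X \<times> X. v \<in> coll p}" by (auto simp: coll_def)
    then have "card (coll p) = card {v\<in>X \<times> X. v \<in> coll p}" by (rule arg_cong)
    then show "card (coll p) = (\<Sum>v\<in>X \<times> X. if v \<in> coll p then 1 else 0)"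
      using finX by (simp add: sum.If_cases Int_def)
  qed simp
  also have "\<dots> = (\<Sum>v\<in>X \<times> X. \<Sum>p\<in>P. if v \<in> coll p then 1 else 0)" by (rule sum.swap)
  also have "\<dots> = (\<Sum>v\<in>X \<times> X. card {p\<in>P. v \<in> coll p})"
    using P(1) by (intro sum.cong) (simp_all add: sum.If_cases Int_def)
  also have "\<dots> \<le> (\<Sum>v\<in>X \<times> X. G * (40 * 2 ^ j))"
    using few by (intro sum_mono) auto
  also have "\<dots> = 2 ^ (80 * j) * (G * (40 * 2 ^ j))"
    by (simp add: card_cartesian_product cX flip: power_add)
  also have "\<dots> = (40 * G * 2 ^ (33 * j)) * 2 ^ (48 * j)"
    by (simp flip: power_add add: mult.assoc mult.left_commute)
  finally show ?thesis by simp
qed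

lemma pow2_sum_union:
  "finite E \<Longrightarrow> finite F \<Longrightarrow> E \<inter> F = {} \<Longrightarrow> pow2_sum G (E \<union> F) = pow2_sum G E + pow2_sum G F"
  unfolding pow2_sum_def by (rule sum.union_disjoint)

lemma pow2_sum_shift: "pow2_sum G ((+) c ` E) = 2 ^ (G * c) * pow2_sum G E"
  unfolding pow2_sum_def
  by (subst sum.reindex) (auto simp: sum_distrib_left distrib_left power_add)

text \<open>Used for shifted copies: raising all exponents by a constant multiplies the sums by a
  unit, which preserves the number of residues.\<close>

lemma card_block_residues_unit_mult:
  fixes u :: int
  assumes u: "coprime u (int p)" and p: "p > 0"
  shows "card ((\<lambda>E. (u * int (pow2_sum G E)) mod int p) ` blocks (2 ^ j)) = card (block_residues p j G)"
proof -
  have "(\<lambda>E. (u * int (pow2_sum G E)) mod int p) ` blocks (2 ^ j) = (\<lambda>x. (u * int x) mod int p) ` block_residues p j G"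
    unfolding block_residues_def image_image by (simp add: zmod_int mod_mult_right_eq)
  moreover have "inj_on (\<lambda>x. (u * int x) mod int p) (block_residues p j G)"
  proof (rule inj_onI)
    fix x y assume xy: "x \<in> block_residues p j G" "y \<in> block_residues p j G" "(u * int x) mod int p = (u * int y) mod int p"
    then have "[u * int x = u * int y] (mod int p)" by (simp only: cong_def)
    then have "[int x = int y] (mod int p)" using u by (simp add: cong_mult_lcancel)
    then have "[x = y] (mod p)" by (simp add: cong_int_iff)
    moreover have "x < p" "y < p" using xy p by (auto simp: block_residues_def)
    ultimately show "x = y" by (simp add: cong_less_imp_eq_nat)
  qed
  ultimately show ?thesis by (simp add: card_image)
qed

definition large_residues :: "nat \<Rightarrow> nat \<Rightarrow> nat \<Rightarrow> bool" where
  "large_residues p j G \<longleftrightarrow> 2 ^ (32 * j) \<le> 2 * card (block_residues p j G)"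

text \<open>The incidence bound is applied to A * B + C + D. With gap G * H in \<open>B\<close>, a
  product of two terms is 2^(G (x + y H)) with x < H, so x and y are base-H digits and the 1600
  exponents are distinct. Shifting \<open>C\<close> and \<open>D\<close> by H^2 and H^2 + H keeps
  the three groups of exponents disjoint.\<close>

lemma every_residue_is_pow2_sum:
  assumes j: "j \<ge> 16" and p: "prime p" "odd p" "p \<le> 2 ^ (40 * (j + 1))" and G: "G > 0"
    and large: "large_residues p j G" "large_residues p j (G * (40 * 2 ^ j))"
  shows "\<exists>E. finite E \<and> card E = 1680 \<and> E \<subseteq> {..<1600 * 4 ^ j + 80 * 2 ^ j} \<and> [int (pow2_sum G E) = r] (mod int p)"
proof -
  define H :: nat where "H = 40 * 2 ^ j"
  define X where "X = blocks (2 ^ j)"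
  have p0: "p > 0" using p(1) prime_gt_0_nat by blast
  have H0: "H > 0" by (simp add: H_def)
  have H2: "1600 * 4 ^ j + 80 * 2 ^ j = H ^ 2 + 2 * H"
    by (simp add: H_def power2_eq_square flip: power_mult_distrib)
  have unit: "coprime (2 ^ n :: int) (int p)" for n
    using p(2) by simp
  define A where "A = (\<lambda>E. int (pow2_sum G E) mod int p) ` X"
  define B where "B = (\<lambda>E. int (pow2_sum (G * H) E) mod int p) ` X"
  define C where "C = (\<lambda>E. (2 ^ (G * H ^ 2) * int (pow2_sum G E)) mod int p) ` X"
  define D where "D = (\<lambda>E. (2 ^ (G * (H ^ 2 + H)) * int (pow2_sum G E)) mod int p) ` X"
  have cA: "card A = card (block_residues p j G)" and cB: "card B = card (block_residues p j (G * H))"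
    using card_block_residues_unit_mult[of 1 p G j] card_block_residues_unit_mult[of 1 p "G * H" j] p0
    by (simp_all add: A_def B_def X_def)
  have cC: "card C = card (block_residues p j G)" and cD: "card D = card (block_residues p j G)"
    unfolding C_def D_def X_def by (intro card_block_residues_unit_mult unit p0)+
  have "p ^ 3 \<le> (2 ^ (40 * (j + 1))) ^ 3" using p(3) by (intro power_mono) auto
  \<comment> \<open>16 collects the factor 2 of \<open>large_residues\<close> from the four sets;
    the comparison 4 + 120 (j + 1) < 128 j below is where j >= 16 enters.\<close>
  then have "16 * p ^ 3 \<le> 2 ^ 4 * (2 ^ (40 * (j + 1))) ^ 3" by simp
  also have "\<dots> = 2 ^ (4 + 120 * (j + 1))" by (simp only: power_add power_mult[symmetric]) simp
  also have "\<dots> < 2 ^ (32 * j * 4)" using j by (intro power_strict_increasing) auto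
  also have "\<dots> = (2 ^ (32 * j)) * (2 ^ (32 * j)) * (2 ^ (32 * j)) * (2 ^ (32 * j))"
    by (simp only: power_add[symmetric]) (rule arg_cong[of _ _ "\<lambda>n. 2 ^ n"], simp)
  also have "\<dots> \<le> (2 * card A) * (2 * card B) * (2 * card C) * (2 * card D)"
    using large unfolding cA cB cC cD large_residues_def H_def by (intro mult_mono) auto
  finally have "p ^ 3 < card A * card B * card C * card D" by simp
  moreover have "A \<subseteq> {0..<int p}" "B \<subseteq> {0..<int p}" "C \<subseteq> {0..<int p}" "D \<subseteq> {0..<int p}"
    using p0 by (auto simp: A_def B_def C_def D_def)
  ultimately obtain a b c d where abcd: "a \<in> A" "b \<in> B" "c \<in> C" "d \<in> D" "[a * b + c + d = r] (mod int p)"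
    using sum_product_solvable[OF p(1)] by meson
  obtain Ea Eb Ec Ed where E: "Ea \<in> X" "Eb \<in> X" "Ec \<in> X" "Ed \<in> X"
    and a: "a = int (pow2_sum G Ea) mod int p" and b: "b = int (pow2_sum (G * H) Eb) mod int p"
    and c: "c = (2 ^ (G * H ^ 2) * int (pow2_sum G Ec)) mod int p"
    and d: "d = (2 ^ (G * (H ^ 2 + H)) * int (pow2_sum G Ed)) mod int p"
    using abcd by (auto simp: A_def B_def C_def D_def)
  have props: "finite S" "card S = 40" "S \<subseteq> {..<H}" if "S \<in> X" for S
    using blocksD[of S "2 ^ j"] that by (auto simp: X_def H_def)
  define E1 where "E1 = (\<lambda>(x, y). x + y * H) ` (Ea \<times> Eb)"
  define E2 where "E2 = (+) (H ^ 2) ` Ec"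
  define E3 where "E3 = (+) (H ^ 2 + H) ` Ed"
  have inj: "inj_on (\<lambda>(x, y). x + y * H) (Ea \<times> Eb)"
  proof (rule inj_onI, clarify)
    fix x y x' y' assume "x \<in> Ea" "x' \<in> Ea" "x + y * H = x' + y' * H"
    moreover from this have "x < H" "x' < H" using props(3)[OF E(1)] by auto
    ultimately show "x = x' \<and> y = y'" using block_index_unique[of x H x' y y'] by blast
  qed
  have s1: "pow2_sum G E1 = pow2_sum G Ea * pow2_sum (G * H) Eb"
  proof -
    have "pow2_sum G E1 = (\<Sum>(x, y)\<in>Ea \<times> Eb. 2 ^ (G * x) * 2 ^ (G * H * y))"
      unfolding pow2_sum_def E1_def by (subst sum.reindex[OF inj]) (auto intro!: sum.cong simp: power_add distrib_left mult_ac simp flip: power_add)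
    also have "\<dots> = pow2_sum G Ea * pow2_sum (G * H) Eb"
      unfolding pow2_sum_def by (simp add: sum_product sum.cartesian_product)
    finally show ?thesis .
  qed
  have fin: "finite E1" "finite E2" "finite E3" using props E by (auto simp: E1_def E2_def E3_def)
  have c1: "card E1 = 1600" unfolding E1_def using inj props E by (simp add: card_image card_cartesian_product)
  have c2: "card E2 = 40" "card E3 = 40" unfolding E2_def E3_def using props E by (simp_all add: card_image)
  have r1: "E1 \<subseteq> {..<H ^ 2}"
  proof
    fix e assume "e \<in> E1"
    then obtain x y where xy: "x \<in> Ea" "y \<in> Eb" "e = x + y * H" by (auto simp: E1_def)
    then have "x < H" "y < H" using props(3) E by blast+
    then have "e < (y + 1) * H" using xy by simp
    also have "\<dots> \<le> H * H" using \<open>y < H\<close> by (intro mult_right_mono) auto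
    finally show "e \<in> {..<H ^ 2}" by (simp add: power2_eq_square)
  qed
  have r2: "E2 \<subseteq> {H ^ 2..<H ^ 2 + H}" using props(3)[OF E(3)] by (auto simp: E2_def)
  have r3: "E3 \<subseteq> {H ^ 2 + H..<H ^ 2 + 2 * H}" using props(3)[OF E(4)] by (auto simp: E3_def)
  have disj: "E1 \<inter> E2 = {}" "(E1 \<union> E2) \<inter> E3 = {}" using r1 r2 r3 by fastforce+
  have s: "pow2_sum G (E1 \<union> E2 \<union> E3) = pow2_sum G E1 + pow2_sum G E2 + pow2_sum G E3"
    using fin disj by (simp add: pow2_sum_union)
  have s2: "pow2_sum G E2 = 2 ^ (G * H ^ 2) * pow2_sum G Ec" and s3: "pow2_sum G E3 = 2 ^ (G * (H ^ 2 + H)) * pow2_sum G Ed"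
    unfolding E2_def E3_def by (rule pow2_sum_shift)+
  have "[int (pow2_sum G (E1 \<union> E2 \<union> E3)) = a * b + c + d] (mod int p)"
    unfolding s s1 s2 s3 a b c d of_nat_add of_nat_mult of_nat_power of_nat_numeral
    by (intro cong_add cong_mult) (simp_all add: cong_def mod_simps)
  then have "[int (pow2_sum G (E1 \<union> E2 \<union> E3)) = r] (mod int p)" using abcd(5) by (rule cong_trans)
  moreover have "card (E1 \<union> E2 \<union> E3) = 1680"
    using fin disj c1 c2 by (simp add: card_Un_disjoint)
  moreover have "E1 \<union> E2 \<union> E3 \<subseteq> {..<1600 * 4 ^ j + 80 * 2 ^ j}"
    unfolding H2 using r1 r2 r3 by fastforce
  moreover have "finite (E1 \<union> E2 \<union> E3)" using fin by simp
  ultimately show ?thesis by (intro exI[of _ "E1 \<union> E2 \<union> E3"] conjI)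
qed

subsection \<open>Smooth parts\<close>

definition smooth_part :: "nat \<Rightarrow> nat \<Rightarrow> nat" where
  "smooth_part y n = (\<Prod>q | prime q \<and> q \<le> y. q ^ multiplicity q n)"

lemma finite_primes_le: "finite {q::nat. prime q \<and> q \<le> y}"
  by (rule finite_subset[of _ "{..y}"]) auto

lemma smooth_part_pos: "smooth_part y n > 0"
  unfolding smooth_part_def by (intro prod_pos) (auto simp: prime_gt_0_nat)

lemma multiplicity_smooth_part:
  assumes "prime p"
  shows "multiplicity p (smooth_part y n) = (if p \<le> y then multiplicity p n else 0)"
  unfolding smooth_part_def using assms
  by (subst multiplicity_prod_prime_powers) (auto simp: finite_primes_le)

lemma smooth_part_dvd: "n > 0 \<Longrightarrow> smooth_part y n dvd n"
  using smooth_part_pos[of y n] by (intro multiplicity_le_imp_dvd) (auto simp: multiplicity_smooth_part)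

lemma prime_dvd_smooth_part: "prime p \<Longrightarrow> p dvd smooth_part y n \<Longrightarrow> p \<le> y \<and> p dvd n"
proof -
  assume p: "prime p" "p dvd smooth_part y n"
  then have "multiplicity p (smooth_part y n) > 0"
    using smooth_part_pos[of y n] by (simp add: prime_multiplicity_gt_zero_iff)
  then have "p \<le> y" "multiplicity p n > 0"
    using p(1) by (auto simp: multiplicity_smooth_part split: if_splits)
  then show "p \<le> y \<and> p dvd n" using not_dvd_imp_multiplicity_0[of p n] by linarith
qed

lemma prime_dvd_cofactor:
  assumes "n > 0" "prime p" "p dvd n div smooth_part y n"
  shows "p > y"
proof (rule ccontr)
  assume "\<not> p > y"
  have n: "n = smooth_part y n * (n div smooth_part y n)" using smooth_part_dvd[OF assms(1)] by simp
  then have "n div smooth_part y n \<noteq> 0" using assms(1) by (metis mult_0_right less_irrefl)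
  then have "multiplicity p n = multiplicity p (smooth_part y n) + multiplicity p (n div smooth_part y n)"
    using n assms smooth_part_pos[of y n]
    by (metis prime_elem_multiplicity_mult_distrib prime_imp_prime_elem less_irrefl)
  moreover have "multiplicity p (n div smooth_part y n) > 0"
    using assms \<open>n div smooth_part y n \<noteq> 0\<close> by (simp add: prime_multiplicity_gt_zero_iff)
  ultimately show False using \<open>\<not> p > y\<close> assms by (simp add: multiplicity_smooth_part)
qed

subsection \<open>Good primes\<close>

text \<open>Meant for primes \<open>p\<close> with \<open>2^(40 j) < p \<le> 2^(40 (j + 1))\<close>; the second scale \<open>40 * 2^j\<close> keeps the exponents
  in the products of \<open>every_residue_is_pow2_sum\<close> distinct.\<close>

definition good_prime :: "nat \<Rightarrow> nat \<Rightarrow> nat \<Rightarrow> bool" where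
  "good_prime y j p \<longleftrightarrow> smooth_part y (p - 1) \<le> 2 ^ j \<and>
     (\<forall>x\<in>{1..<2 ^ (5 * j)}. \<not> p dvd 2 ^ x - 1) \<and>
     (\<forall>G\<in>{1..2 ^ j}. large_residues p j G \<and> large_residues p j (G * (40 * 2 ^ j)))"

lemma good_prime_sums:
  assumes "j \<ge> 16" "prime p" "odd p" "p \<le> 2 ^ (40 * (j + 1))" "good_prime y j p"
  shows "\<exists>E. finite E \<and> card E = 1680 \<and> E \<subseteq> {..<1600 * 4 ^ j + 80 * 2 ^ j} \<and>
    [int (pow2_sum (smooth_part y (p - 1)) E) = r] (mod int p)"
proof (rule every_residue_is_pow2_sum[OF assms(1-4) smooth_part_pos])
  have "smooth_part y (p - 1) \<in> {1..2 ^ j}"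
    using assms(5) smooth_part_pos[of y "p - 1"] by (auto simp: good_prime_def)
  then show "large_residues p j (smooth_part y (p - 1))"
    "large_residues p j (smooth_part y (p - 1) * (40 * 2 ^ j))"
    using assms(5) by (simp_all add: good_prime_def)
qed

text \<open>The order of 2 modulo p is at least 2^(5 j) and the smooth part is at most 2^j, so
  passing to the power still leaves order at least 2^(4 j). This room is what later keeps the
  exponents distinct.\<close>

lemma good_prime_order:
  assumes "good_prime y j p" "0 < x" "x < 2 ^ (4 * j)"
  shows "\<not> p dvd 2 ^ (smooth_part y (p - 1) * x) - 1"
proof -
  have "smooth_part y (p - 1) * x < 2 ^ j * 2 ^ (4 * j)"
    using assms by (intro mult_le_less_imp_less) (auto simp: good_prime_def smooth_part_pos)
  also have "\<dots> = 2 ^ (5 * j)" by (simp flip: power_add)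
  finally show ?thesis
    using assms smooth_part_pos[of y "p - 1"] by (auto simp: good_prime_def Suc_le_eq)
qed

section \<open>Counting the primes that fail to be good\<close>

text \<open>Pigeonhole over the at most \<open>y\<close> primes up to \<open>y\<close>: a smooth
  part above 2^j contains a prime power above 2^(j div y). Keeping only the least such power of each
  q leaves at most \<open>y\<close> moduli, each dividing at most U / 2^(j div y) numbers up to
  \<open>U\<close>.\<close>

lemma card_primes_large_smooth_part_le:
  fixes P :: "nat set"
  assumes y: "y > 0" and P: "\<And>p. p \<in> P \<Longrightarrow> 1 < p \<and> p \<le> U \<and> smooth_part y (p - 1) > 2 ^ j"
  shows "real (card P) \<le> real U * (y / 2 ^ (j div y))"
proof -
  define h where "h = j div y"
  define Q where "Q = {q. prime q \<and> q \<le> y}"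
  define e where "e q = (LEAST e. q ^ e > 2 ^ h)" for q :: nat
  have finQ: "finite Q" by (simp add: Q_def finite_primes_le)
  have cQ: "card Q \<le> y"
  proof -
    have "Q \<subseteq> {1..y}" by (auto simp: Q_def Suc_le_eq prime_gt_0_nat)
    then have "card Q \<le> card {1..y}" by (intro card_mono) auto
    then show ?thesis by simp
  qed
  have e: "q ^ e q > 2 ^ h" if "q \<in> Q" for q
    unfolding e_def
  proof (rule LeastI)
    have "2 ^ h < (2::nat) ^ Suc h" by simp
    also have "\<dots> \<le> q ^ Suc h" using that by (intro power_mono) (auto simp: Q_def prime_ge_2_nat)
    finally show "q ^ Suc h > 2 ^ h" .
  qed
  have dvd: "\<exists>q\<in>Q. q ^ e q dvd p - 1" if p: "p \<in> P" for p
  proof (rule ccontr)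
    assume none: "\<not> ?thesis"
    have "q ^ multiplicity q (p - 1) \<le> 2 ^ h" if q: "q \<in> Q" for q
    proof (rule ccontr)
      assume "\<not> ?thesis"
      then have "e q \<le> multiplicity q (p - 1)" unfolding e_def by (intro Least_le) simp
      then have "q ^ e q dvd p - 1" by (rule multiplicity_dvd')
      then show False using none q by blast
    qed
    then have "smooth_part y (p - 1) \<le> (\<Prod>q\<in>Q. 2 ^ h)"
      unfolding smooth_part_def Q_def by (intro prod_mono) auto
    also have "\<dots> = 2 ^ (h * card Q)" by (simp add: power_mult)
    also have "\<dots> \<le> 2 ^ j"
    proof (rule power_increasing)
      have "h * card Q \<le> h * y" using cQ by simp
      also have "\<dots> \<le> j" by (simp add: h_def)
      finally show "h * card Q \<le> j" .
    qed simp
    finally show False using P[OF p] by simp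
  qed
  have "(\<lambda>p. p - 1) ` P \<subseteq> {k\<in>{1..U}. \<exists>q\<in>Q. q ^ e q dvd k}"
    using P dvd by fastforce
  then have "card ((\<lambda>p. p - 1) ` P) \<le> card {k\<in>{1..U}. \<exists>q\<in>Q. q ^ e q dvd k}"
    by (intro card_mono) auto
  moreover have "inj_on (\<lambda>p. p - 1) P"
  proof (rule inj_onI)
    fix x z assume "x \<in> P" "z \<in> P" "x - 1 = z - 1"
    then show "x = z" using P[of x] P[of z] by linarith
  qed
  ultimately have "real (card P) \<le> real (card {k\<in>{1..U}. \<exists>q\<in>Q. q ^ e q dvd k})"
    by (simp add: card_image)
  also have "\<dots> \<le> U * (\<Sum>q\<in>Q. 1 / real (q ^ e q))"
    using finQ by (intro card_some_divisor_le) (auto simp: Q_def prime_gt_0_nat)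
  also have "\<dots> \<le> U * (\<Sum>q\<in>Q. 1 / 2 ^ h)"
  proof (intro mult_left_mono sum_mono)
    fix q assume "q \<in> Q"
    then have "real (2 ^ h) \<le> real (q ^ e q)" using e[of q] by (intro of_nat_mono) simp
    then show "1 / real (q ^ e q) \<le> 1 / 2 ^ h"
      using \<open>q \<in> Q\<close> by (intro divide_left_mono mult_pos_pos) (auto simp: Q_def prime_gt_0_nat)
  qed simp
  also have "\<dots> \<le> U * (y / 2 ^ h)"
    using cQ by (intro mult_left_mono) (auto simp: divide_right_mono)
  finally show ?thesis by (simp add: h_def)
qed

text \<open>\<open>2 ^ x - 1\<close> has at most x prime divisors, and there are fewer than
  \<open>B\<close> values of x.\<close>

lemma card_small_order_le:
  assumes "finite P" "\<And>p. p \<in> P \<Longrightarrow> prime p \<and> (\<exists>x\<in>{1..<B}. p dvd (2::nat) ^ x - 1)"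
  shows "card P \<le> B * B"
proof -
  have "P = (\<Union>x\<in>{1..<B}. {p\<in>P. p dvd (2::nat) ^ x - 1})" using assms(2) by auto
  then have "card P \<le> (\<Sum>x\<in>{1..<B}. card {p\<in>P. p dvd (2::nat) ^ x - 1})"
    using card_UN_le[of "{1..<B}" "\<lambda>x. {p\<in>P. p dvd (2::nat) ^ x - 1}"] by simp
  also have "\<dots> \<le> (\<Sum>x\<in>{1..<B}. B)"
  proof (rule sum_mono)
    fix x assume x: "x \<in> {1..<B}"
    have "card {p\<in>P. p dvd (2::nat) ^ x - 1} \<le> x"
    proof (rule card_prime_divisors_le[of _ "2 ^ x - 1"])
      have "2 ^ 1 \<le> (2::nat) ^ x" using x by (intro power_increasing) auto
      then show "(2::nat) ^ x - 1 > 0" by simp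
      show "finite {p\<in>P. p dvd (2::nat) ^ x - 1}" using assms(1) by simp
      show "prime p \<and> p dvd 2 ^ x - 1" if "p \<in> {p\<in>P. p dvd (2::nat) ^ x - 1}" for p
        using that assms(2) by blast
    qed simp
    then show "card {p\<in>P. p dvd (2::nat) ^ x - 1} \<le> B" using x by simp
  qed
  also have "\<dots> \<le> B * B" by simp
  finally show ?thesis .
qed

text \<open>The fifth power is what turns y / 2^(j div y) into a multiple of 1 / j^2 under y^2 <=
  j.\<close>

lemma fifth_power_le: "\<exists>C>0. \<forall>h::nat. real (h + 1) ^ 5 \<le> C * 2 ^ h"
proof -
  have "(\<lambda>h::nat. real (h + 1) ^ 5 / 2 ^ h) \<longlonglongrightarrow> 0" by real_asymp
  then have "Bseq (\<lambda>h::nat. real (h + 1) ^ 5 / 2 ^ h)" by (intro convergent_imp_Bseq convergentI)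
  then obtain C where "C > 0" "\<And>h::nat. norm (real (h + 1) ^ 5 / 2 ^ h) \<le> C" by (auto elim: BseqE)
  then show ?thesis by (intro exI[of _ C]) (auto simp: divide_le_eq)
qed

lemma card_not_large_residues_le:
  assumes P: "finite P" "\<And>p. p \<in> P \<Longrightarrow> prime p \<and> (\<exists>G\<in>{1..2 ^ j}. \<not> large_residues p j (G * c))"
    and c: "c > 0"
  shows "card P \<le> 40 * c * 2 ^ (35 * j)"
proof -
  have "P = (\<Union>G\<in>{1..2 ^ j}. {p\<in>P. \<not> large_residues p j (G * c)})" using P(2) by auto
  then have "card P \<le> (\<Sum>G\<in>{1..2 ^ j}. card {p\<in>P. \<not> large_residues p j (G * c)})"
    using card_UN_le[of "{1..2 ^ j}" "\<lambda>G. {p\<in>P. \<not> large_residues p j (G * c)}"] by simp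
  also have "\<dots> \<le> (\<Sum>G\<in>{1..(2::nat) ^ j}. 40 * (2 ^ j * c) * 2 ^ (33 * j))"
  proof (rule sum_mono)
    fix G :: nat assume G: "G \<in> {1..2 ^ j}"
    have "card {p\<in>P. \<not> large_residues p j (G * c)} \<le> 40 * (G * c) * 2 ^ (33 * j)"
      using P c G by (intro card_small_block_residues_le[where j = j]) (auto simp: large_residues_def)
    also have "\<dots> \<le> 40 * (2 ^ j * c) * 2 ^ (33 * j)" using G by simp
    finally show "card {p\<in>P. \<not> large_residues p j (G * c)} \<le> 40 * (2 ^ j * c) * 2 ^ (33 * j)" .
  qed
  also have "\<dots> = 40 * c * (2 ^ j * 2 ^ j * 2 ^ (33 * j))" by simp
  also have "2 ^ j * 2 ^ j * 2 ^ (33 * j) = (2::nat) ^ (35 * j)" by (simp only: power_add[symmetric]) (rule arg_cong[of _ _ "\<lambda>n. 2 ^ n"], simp)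
  finally show ?thesis .
qed

text \<open>One set for each way to fail. Small orders cost at most 2^(10 j) primes and the two
  residue conditions 40 * 2^(35 j) and 1600 * 2^(36 j), so 1641 = 1 + 40 + 1600 and the saving over
  2^(40 j) is 2^(4 j).\<close>

lemma card_bad_primes_le:
  fixes y j :: nat
  assumes y: "y > 0" 
  defines "P \<equiv> {p. prime p \<and> 2 ^ (40 * j) < p \<and> p \<le> 2 ^ (40 * (j + 1)) \<and> \<not> good_prime y j p}"
  shows "real (card P) \<le> 2 ^ (40 * j) * (2 ^ 40 * (y / 2 ^ (j div y)) + 1641 / 2 ^ (4 * j))"
proof -
  define P1 where "P1 = {p\<in>P. smooth_part y (p - 1) > 2 ^ j}"
  define P2 where "P2 = {p\<in>P. \<exists>x\<in>{1..<2 ^ (5 * j)}. p dvd 2 ^ x - 1}"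
  define P3 where "P3 = {p\<in>P. \<exists>G\<in>{1..2 ^ j}. \<not> large_residues p j (G * 1)}"
  define P4 where "P4 = {p\<in>P. \<exists>G\<in>{1..2 ^ j}. \<not> large_residues p j (G * (40 * 2 ^ j))}"
  have fin: "finite P" unfolding P_def by (rule finite_subset[of _ "{..2 ^ (40 * (j + 1))}"]) auto
  have prime: "prime p" if "p \<in> P" for p using that by (simp add: P_def)
  have "P = P1 \<union> P2 \<union> P3 \<union> P4"
    by (auto simp: P_def P1_def P2_def P3_def P4_def good_prime_def not_le)
  then have "card P = card (P1 \<union> P2 \<union> P3 \<union> P4)" by (rule arg_cong)
  then have "card P \<le> card P1 + card P2 + card P3 + card P4"
    using card_Un_le[of "P1 \<union> P2 \<union> P3" P4] card_Un_le[of "P1 \<union> P2" P3] card_Un_le[of P1 P2] by linarith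
  moreover have "real (card P1) \<le> real (2 ^ (40 * (j + 1))) * (y / 2 ^ (j div y))"
  proof (rule card_primes_large_smooth_part_le[OF y])
    fix p assume "p \<in> P1"
    then have "prime p" "p \<le> 2 ^ (40 * (j + 1))" "smooth_part y (p - 1) > 2 ^ j"
      unfolding P1_def P_def by blast+
    then show "1 < p \<and> p \<le> 2 ^ (40 * (j + 1)) \<and> smooth_part y (p - 1) > 2 ^ j"
      using prime_gt_1_nat by blast
  qed
  moreover have "card P2 \<le> 2 ^ (5 * j) * 2 ^ (5 * j)"
  proof (rule card_small_order_le)
    show "finite P2" using fin by (simp add: P2_def)
    fix p assume "p \<in> P2"
    then show "prime p \<and> (\<exists>x\<in>{1..<2 ^ (5 * j)}. p dvd (2::nat) ^ x - 1)"
      unfolding P2_def using prime by blast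
  qed
  moreover have "card P3 \<le> 40 * 1 * 2 ^ (35 * j)"
  proof (rule card_not_large_residues_le)
    show "finite P3" using fin by (simp add: P3_def)
    fix p assume "p \<in> P3"
    then show "prime p \<and> (\<exists>G\<in>{1..2 ^ j}. \<not> large_residues p j (G * 1))"
      unfolding P3_def using prime by blast
  qed simp
  moreover have "card P4 \<le> 40 * (40 * 2 ^ j) * 2 ^ (35 * j)"
  proof (rule card_not_large_residues_le)
    show "finite P4" using fin by (simp add: P4_def)
    fix p assume "p \<in> P4"
    then show "prime p \<and> (\<exists>G\<in>{1..2 ^ j}. \<not> large_residues p j (G * (40 * 2 ^ j)))"
      unfolding P4_def using prime by blast
  qed simp
  ultimately have "real (card P) \<le> real (2 ^ (40 * (j + 1))) * (y / 2 ^ (j div y))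
      + real (2 ^ (5 * j) * 2 ^ (5 * j) + 40 * 1 * 2 ^ (35 * j) + 40 * (40 * 2 ^ j) * 2 ^ (35 * j))"
    by linarith
  also have "real (2 ^ (5 * j) * 2 ^ (5 * j) + 40 * 1 * 2 ^ (35 * j) + 40 * (40 * 2 ^ j) * 2 ^ (35 * j)) \<le> real (1641 * (2::nat) ^ (36 * j))"
  proof -
    have "2 ^ (5 * j) * 2 ^ (5 * j) \<le> (2::nat) ^ (36 * j)"
      unfolding power_add[symmetric] by (intro power_increasing) auto
    moreover have "(2::nat) ^ (35 * j) \<le> 2 ^ (36 * j)" by (intro power_increasing) auto
    moreover have "40 * (40 * 2 ^ j) * 2 ^ (35 * j) = 1600 * (2 ^ j * 2 ^ (35 * j) :: nat)"
      by (simp only: mult.assoc[symmetric])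
    moreover have "2 ^ j * 2 ^ (35 * j) = (2::nat) ^ (36 * j)" by (simp flip: power_add)
    ultimately have "2 ^ (5 * j) * 2 ^ (5 * j) + 40 * 1 * 2 ^ (35 * j) + 40 * (40 * 2 ^ j) * 2 ^ (35 * j) \<le> 1641 * (2::nat) ^ (36 * j)"
      by linarith
    then show ?thesis by (rule of_nat_mono)
  qed
  also have "real (1641 * 2 ^ (36 * j)) = 2 ^ (40 * j) * (1641 / 2 ^ (4 * j))"
  proof -
    have "(2::real) ^ (40 * j) = 2 ^ (36 * j) * 2 ^ (4 * j)"
      unfolding power_add[symmetric] by (rule arg_cong[of _ _ "\<lambda>n. 2 ^ n"]) simp
    moreover have *: "real (1641 * a) = real a * z * (1641 / z)" if "z > 0" for a :: nat and z :: real
      using that by simp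
    moreover have "real (1641 * 2 ^ (36 * j)) = real (2 ^ (36 * j)) * 2 ^ (4 * j) * (1641 / 2 ^ (4 * j))"
      by (rule *) (rule zero_less_power, simp)
    ultimately show ?thesis by (simp only: of_nat_power of_nat_numeral)
  qed
  also have "real (2 ^ (40 * (j + 1))) = 2 ^ (40 * j) * 2 ^ 40"
    by (simp only: of_nat_mult of_nat_power of_nat_numeral distrib_left power_add mult_1_right)
  finally show ?thesis by (simp only: distrib_left mult.assoc of_nat_le_iff)
qed

lemma sum_bad_primes_dyadic_le:
  "\<exists>K>0. \<forall>y j::nat. y > 0 \<longrightarrow> y\<^sup>2 \<le> j \<longrightarrow>
    (\<Sum>p | prime p \<and> 2 ^ (40 * j) < p \<and> p \<le> 2 ^ (40 * (j + 1)) \<and> \<not> good_prime y j p. 1 / real p) \<le> K / (real j)\<^sup>2"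
proof -
  obtain C where C: "C > 0" "\<And>h::nat. real (h + 1) ^ 5 \<le> C * 2 ^ h" using fifth_power_le by auto
  have "(\<Sum>p | prime p \<and> 2 ^ (40 * j) < p \<and> p \<le> 2 ^ (40 * (j + 1)) \<and> \<not> good_prime y j p. 1 / real p)
      \<le> (2 ^ 40 * C + 1641) / (real j)\<^sup>2" (is "sum _ ?P \<le> _") if y: "y > 0" "y\<^sup>2 \<le> j" for y j :: nat
  proof -
    have j: "j > 0" using y by (cases j) auto
    have "(\<Sum>p\<in>?P. 1 / real p) \<le> (\<Sum>p\<in>?P. 1 / 2 ^ (40 * j))"
    proof (rule sum_mono)
      fix p assume "p \<in> ?P"
      then have "real (2 ^ (40 * j)) \<le> real p" by (intro of_nat_mono) simp
      then show "1 / real p \<le> 1 / 2 ^ (40 * j)" by (intro divide_left_mono mult_pos_pos) (auto intro: less_le_trans[of 0 "2 ^ (40 * j)"])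
    qed
    also have "\<dots> = real (card ?P) / 2 ^ (40 * j)" by simp
    also have "\<dots> \<le> 2 ^ 40 * (y / 2 ^ (j div y)) + 1641 / 2 ^ (4 * j)"
      using card_bad_primes_le[OF y(1), of j] by (simp add: divide_le_eq mult.commute)
    \<comment> \<open>With h = j div y, j < (h + 1) y gives j^5 <= C 2^h y^5. Multiplying by y and
      inserting y^6 <= j^3 yields y * j^2 <= C 2^h.\<close>
    also have "real y / 2 ^ (j div y) \<le> C / (real j)\<^sup>2"
    proof -
      define h where "h = j div y"
      have "j < (h + 1) * y"
        unfolding h_def using y(1) by (metis Suc_eq_plus1 dividend_less_div_times add.commute mult.commute mult_Suc)
      then have "real j \<le> real (h + 1) * real y" by (metis less_imp_le of_nat_le_iff of_nat_mult)
      then have "real j ^ 5 \<le> (real (h + 1) * real y) ^ 5" by (intro power_mono) auto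
      also have "\<dots> = real (h + 1) ^ 5 * real y ^ 5" by (rule power_mult_distrib)
      also have "\<dots> \<le> (C * 2 ^ h) * real y ^ 5" using C(2)[of h] by (intro mult_right_mono) auto
      finally have 1: "real j ^ 5 \<le> C * 2 ^ h * real y ^ 5" .
      have "(real y ^ 2) ^ 3 \<le> real j ^ 3"
        using y(2) by (intro power_mono) (auto simp flip: of_nat_power)
      then have 2: "real y ^ 6 \<le> real j ^ 3" by (simp flip: power_mult)
      have "real y * real j ^ 5 \<le> real y * (C * 2 ^ h * real y ^ 5)" using 1 by (intro mult_left_mono) auto
      also have "\<dots> = C * 2 ^ h * real y ^ 6" by (simp add: power_numeral_reduce)
      also have "\<dots> \<le> C * 2 ^ h * real j ^ 3" using 2 C by (intro mult_left_mono) auto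
      finally have "(real y * real j ^ 2) * real j ^ 3 \<le> (C * 2 ^ h) * real j ^ 3"
        by (simp add: mult.assoc flip: power_add)
      then have "real y * real j ^ 2 \<le> C * 2 ^ h" using j by (simp only: mult_le_cancel_right_pos zero_less_power of_nat_0_less_iff)
      then show ?thesis unfolding h_def[symmetric] using j by (simp add: field_simps)
    qed
    also have "1641 / 2 ^ (4 * j) \<le> 1641 / (real j)\<^sup>2"
    proof -
      have "real j < 2 ^ j" by (rule of_nat_less_two_power)
      then have "(real j)\<^sup>2 \<le> (2 ^ j)\<^sup>2" by (intro power_mono) auto
      also have "\<dots> = 2 ^ (2 * j)" by (simp add: mult.commute flip: power_mult)
      also have "\<dots> \<le> (2::real) ^ (4 * j)" by (intro power_increasing) auto
      finally show ?thesis using j by (intro divide_left_mono) auto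
    qed
    finally show ?thesis by (simp add: add_divide_distrib)
  qed
  then show ?thesis using C(1) by (intro exI[of _ "2 ^ 40 * C + 1641"]) auto
qed

lemma sum_inverse_squares_le:
  assumes "a \<ge> 1"
  shows "(\<Sum>j=a..b. 1 / (real j)\<^sup>2) \<le> 2 / a"
proof (cases "a \<le> b")
  case True
  have "(\<Sum>j=a..b. 1 / (real j)\<^sup>2) \<le> 2 / a - 1 / b"
    using True
  proof (induction b rule: dec_induct)
    case base
    have "1 / (real a)\<^sup>2 \<le> 1 / a" using assms by (simp add: field_simps power2_eq_square)
    then show ?case by simp
  next
    case (step n)
    have "1 / (real (Suc n))\<^sup>2 \<le> 1 / n - 1 / real (Suc n)"
      using step assms by (simp add: divide_simps power2_eq_square)
    then show ?case using step by simp
  qed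
  moreover have "1 / real b \<ge> 0" by simp
  ultimately show ?thesis by linarith
qed simp

text \<open>The series of 1 / j^2 from y^2 on contributes 2 / y^2; only j <= N matter, since 2^(40
  j) < p <= N.\<close>

lemma sum_bad_primes_le:
  "\<exists>K>0. \<forall>y N::nat. y > 0 \<longrightarrow>
    (\<Sum>p | prime p \<and> p \<le> N \<and> (\<exists>j\<ge>y\<^sup>2. 2 ^ (40 * j) < p \<and> p \<le> 2 ^ (40 * (j + 1)) \<and> \<not> good_prime y j p). 1 / real p) \<le> K / (real y)\<^sup>2"
proof -
  define P where "P y j = {p. prime p \<and> 2 ^ (40 * j) < p \<and> p \<le> 2 ^ (40 * (j + 1)) \<and> \<not> good_prime y j p}" for y j
  obtain K where K: "K > 0" "\<And>y j::nat. y > 0 \<Longrightarrow> y\<^sup>2 \<le> j \<Longrightarrow> (\<Sum>p\<in>P y j. 1 / real p) \<le> K / (real j)\<^sup>2"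
    using sum_bad_primes_dyadic_le unfolding P_def by blast
  have fin: "finite (P y j)" for y j unfolding P_def by (rule finite_subset[of _ "{..2 ^ (40 * (j + 1))}"]) auto
  have "(\<Sum>p | prime p \<and> p \<le> N \<and> (\<exists>j\<ge>y\<^sup>2. 2 ^ (40 * j) < p \<and> p \<le> 2 ^ (40 * (j + 1)) \<and> \<not> good_prime y j p). 1 / real p)
      \<le> 2 * K / (real y)\<^sup>2" (is "sum _ ?S \<le> _") if y: "y > 0" for y N :: nat
  proof -
    have "?S \<subseteq> (\<Union>j\<in>{y\<^sup>2..N}. P y j)"
    proof
      fix p assume "p \<in> ?S"
      then obtain j where j: "prime p" "p \<le> N" "y\<^sup>2 \<le> j" "2 ^ (40 * j) < p" "p \<le> 2 ^ (40 * (j + 1))" "\<not> good_prime y j p" by auto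
      have "j \<le> 40 * j" by simp
      also have "40 * j < 2 ^ (40 * j)" by (rule less_exp)
      finally have "j \<le> N" using j by linarith
      then show "p \<in> (\<Union>j\<in>{y\<^sup>2..N}. P y j)" using j by (auto simp: P_def)
    qed
    then have "sum (\<lambda>p. 1 / real p) ?S \<le> (\<Sum>p\<in>(\<Union>j\<in>{y\<^sup>2..N}. P y j). 1 / real p)"
      using fin by (intro sum_mono2) auto
    also have "\<dots> \<le> (\<Sum>j=y\<^sup>2..N. \<Sum>p\<in>P y j. 1 / real p)"
      using fin by (intro sum_UN_le) auto
    also have "\<dots> \<le> (\<Sum>j=y\<^sup>2..N. K / (real j)\<^sup>2)"
      using y by (intro sum_mono K) auto
    also have "\<dots> = K * (\<Sum>j=y\<^sup>2..N. 1 / (real j)\<^sup>2)" by (simp add: sum_distrib_left)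
    also have "\<dots> \<le> K * (2 / real (y\<^sup>2))"
      using y K by (intro mult_left_mono sum_inverse_squares_le) auto
    finally show ?thesis by (simp add: mult.commute)
  qed
  then show ?thesis using K(1) by (intro exI[of _ "2 * K"]) auto
qed

subsection \<open>Combining the prime factors\<close>

text \<open>With b_i the binary digits of x, the powers 2^(i + b_i) add up to 2^c - 1 + x: each
  digit decides whether its power is doubled. So the number of summands is always exactly
  \<open>c\<close>; repetitions are allowed.\<close>

lemma interval_sum_of_powers_of_2:
  "x < 2 ^ c \<Longrightarrow> \<exists>f. (\<Sum>i<c. 2 ^ f i) = 2 ^ c - 1 + (x::nat)"
proof (induction c arbitrary: x)
  case (Suc c)
  define b :: nat where "b = (if x < 2 ^ c then 0 else 1)"
  have "x - b * 2 ^ c < 2 ^ c" "b * 2 ^ c \<le> x" using Suc.prems by (auto simp: b_def)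
  then obtain f where f: "(\<Sum>i<c. 2 ^ f i) = 2 ^ c - 1 + (x - b * 2 ^ c)" using Suc.IH by blast
  have "(\<Sum>i<Suc c. 2 ^ (f(c := c + b)) i) = (\<Sum>i<c. 2 ^ f i) + 2 ^ (c + b)" by simp
  also have "\<dots> = 2 ^ Suc c - 1 + x"
    using f \<open>b * 2 ^ c \<le> x\<close> by (auto simp: b_def)
  finally show ?case by blast
qed simp

text \<open>The 2^c consecutive integers from 2^c - 1 on meet every class modulo n <= 2^c.\<close>

lemma every_residue_sum_of_powers_of_2:
  assumes "n > 0" "n \<le> 2 ^ c"
  shows "\<exists>f. [(\<Sum>i<c. 2 ^ f i) = r] (mod int n)"
proof -
  define x where "x = nat ((r - (2 ^ c - 1)) mod int n)"
  have ix: "int x = (r - (2 ^ c - 1)) mod int n" using assms by (simp add: x_def)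
  then have "int x < int n" using assms by simp
  then have "x < 2 ^ c" using assms by linarith
  then obtain f where f: "(\<Sum>i<c. 2 ^ f i) = 2 ^ c - 1 + x" using interval_sum_of_powers_of_2 by blast
  have "(\<Sum>i<c. 2 ^ f i) = int (\<Sum>i<c. 2 ^ f i)" by simp
  also have "\<dots> = (2 ^ c - 1) + (r - (2 ^ c - 1)) mod int n" unfolding f ix[symmetric] by (simp add: of_nat_diff Suc_le_eq)
  also have "[\<dots> = (2 ^ c - 1) + (r - (2 ^ c - 1))] (mod int n)" by (simp add: cong_def mod_simps)
  finally show ?thesis by (intro exI[of _ f]) simp
qed

lemma pow2_cong_totient:
  assumes "odd n" "[e = e'] (mod totient n)"
  shows "[(2::int) ^ e = 2 ^ e'] (mod int n)"
proof -
  have cop: "coprime n 2" using assms(1) by simp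
  have "ord n 2 dvd totient n"
    using euler_theorem[of 2 n] cop by (simp add: coprime_commute flip: ord_divides)
  then have "[e = e'] (mod ord n 2)" using assms(2) cong_dvd_modulus_nat by blast
  then have "[2 ^ e = 2 ^ e'] (mod n)" using cop by (simp add: order_divides_expdiff)
  then have "[int (2 ^ e) = int (2 ^ e')] (mod int n)" by (simp only: cong_int_iff)
  then show ?thesis by simp
qed

text \<open>When large square factors are excluded, this traces a large prime factor of the totient
  back to some p - 1, where the hypothesis on common prime factors applies.\<close>

lemma prime_dvd_totient:
  fixes q n :: nat
  assumes "prime q" "q dvd totient n" "n > 0"
  shows "q ^ 2 dvd n \<or> (\<exists>p. prime p \<and> p dvd n \<and> q dvd p - 1)"
proof -
  have "q dvd (\<Prod>p\<in>prime_factors n. p ^ (multiplicity p n - 1) * (p - 1))"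
    using assms totient_formula1 by metis
  then obtain p where p: "p \<in> prime_factors n" "q dvd p ^ (multiplicity p n - 1) * (p - 1)"
    using assms(1) by (auto simp: prime_dvd_prod_iff)
  then have pp: "prime p" "p dvd n" by auto
  show ?thesis
  proof (cases "q dvd p - 1")
    case False
    then have "q dvd p ^ (multiplicity p n - 1)" using p assms(1) prime_dvd_mult_iff by blast
    then have "q dvd p" "multiplicity p n - 1 \<noteq> 0"
      using assms(1) prime_dvd_power by (blast, metis One_nat_def not_prime_unit power_0)
    then have "q = p" "2 \<le> multiplicity p n" using assms(1) pp primes_dvd_imp_eq by auto
    then show ?thesis using multiplicity_dvd' by blast
  qed (use pp in blast)
qed

lemma dvd_by_smooth_part:
  fixes k :: nat and x :: int
  assumes k: "k > 0" and sqf: "\<And>p. prime p \<Longrightarrow> p > z \<Longrightarrow> \<not> p ^ 2 dvd k"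
    and smooth: "int (smooth_part z k) dvd x"
    and rough: "\<And>p. prime p \<Longrightarrow> p dvd k \<Longrightarrow> p > z \<Longrightarrow> int p dvd x"
  shows "int k dvd x"
proof (cases "x = 0")
  case False
  have "k dvd nat \<bar>x\<bar>"
  proof (rule multiplicity_le_imp_dvd)
    fix p :: nat assume p: "prime p"
    show "multiplicity p k \<le> multiplicity p (nat \<bar>x\<bar>)"
    proof (cases "p \<le> z")
      case True
      then have "multiplicity p k = multiplicity p (smooth_part z k)" using p by (simp add: multiplicity_smooth_part)
      also have "\<dots> \<le> multiplicity p (nat \<bar>x\<bar>)"
        using smooth False by (intro dvd_imp_multiplicity_le) (auto simp: nat_dvd_iff int_dvd_int_iff zdvd1_eq dvd_nat_abs_iff)
      finally show ?thesis .
    next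
      case False
      then have "multiplicity p k < 2"
        using sqf[OF p] multiplicity_dvd'[of 2 p k] by (meson not_le)
      moreover have "multiplicity p (nat \<bar>x\<bar>) \<ge> 1" if "multiplicity p k \<ge> 1"
      proof -
        have "p dvd k" using that not_dvd_imp_multiplicity_0[of p k] by linarith
        then have "p dvd nat \<bar>x\<bar>" using rough[OF p] False by (simp add: dvd_nat_abs_iff)
        then show ?thesis using p \<open>x \<noteq> 0\<close> by (simp add: Suc_le_eq prime_multiplicity_gt_zero_iff)
      qed
      ultimately show ?thesis by linarith
    qed
  qed (use False k in auto)
  then show ?thesis by (simp add: dvd_nat_abs_iff)
qed simp

text \<open>Exponents known only modulo \<open>R\<close>, not modulo p - 1, still separate the
  powers of \<open>2 ^ L\<close>. For t the order of 2 and d = L x - L x': multiplying the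
  congruences modulo R by L makes them hold modulo L R, so t divides L d; and t divides R d because
  L divides d. Coprimality of L and R gives t dvd d.\<close>

lemma cong_mod_order_cancel:
  fixes L R x x' a a' p :: nat
  assumes p: "prime p" "odd p" "p - 1 = L * R" "coprime L R"
    and a: "[a = L * x] (mod R)" "[a' = L * x'] (mod R)"
    and eq: "[a = a'] (mod ord p 2)"
  shows "[2 ^ (L * x) = 2 ^ (L * x')] (mod p)"
proof -
  define t where "t = int (ord p 2)"
  have cop: "coprime p 2" using p(2) by simp
  have "ord p 2 dvd p - 1"
    using fermat_theorem[OF p(1), of 2] p by (metis cop coprime_absorb_left coprime_commute not_prime_unit ord_divides)
  then have tLR: "t dvd int L * int R" by (metis p(3) t_def int_dvd_int_iff of_nat_mult)
  define d where "d = int L * int x - int L * int x'"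
  have "int R dvd int a - int L * int x" "int R dvd int a' - int L * int x'"
    using a by (metis cong_iff_dvd_diff cong_int_iff of_nat_mult)+
  then have "int R dvd (int a - int L * int x) - (int a' - int L * int x')" by (rule dvd_diff)
  then have "int L * int R dvd int L * ((int a - int L * int x) - (int a' - int L * int x'))" by (rule mult_dvd_mono[OF dvd_refl])
  then have "t dvd int L * ((int a - int L * int x) - (int a' - int L * int x'))" using tLR dvd_trans by blast
  moreover have "t dvd int a - int a'" using eq by (metis cong_iff_dvd_diff cong_int_iff t_def)
  then have "t dvd int L * (int a - int a')" by simp
  ultimately have "t dvd int L * (int a - int a') - int L * ((int a - int L * int x) - (int a' - int L * int x'))" by (rule dvd_diff[rotated])
  also have "int L * (int a - int a') - int L * ((int a - int L * int x) - (int a' - int L * int x')) = int L * d"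
    by (simp add: d_def algebra_simps)
  finally have tL: "t dvd int L * d" .
  have "int R * d = int L * int R * (int x - int x')" by (simp add: d_def algebra_simps)
  then have tR: "t dvd int R * d" using tLR by (metis dvd_mult2)
  have "coprime (int L) (int R)" using p(4) by simp
  then obtain u v where "u * int L + v * int R = 1" using bezout_int[of "int L" "int R"] by (metis coprime_iff_gcd_eq_1)
  then have "d = u * (int L * d) + v * (int R * d)" by (metis distrib_right mult.assoc mult_1_left)
  then have "t dvd d" using tL tR by (metis dvd_add dvd_mult)
  then have "[L * x = L * x'] (mod ord p 2)" by (simp add: d_def t_def cong_iff_dvd_diff flip: cong_int_iff)
  then show ?thesis using cop by (simp add: order_divides_expdiff)
qed

lemma pow2_cong_imp_dvd:
  fixes p a b :: nat
  assumes "odd p" "[2 ^ a = 2 ^ b] (mod p)" "a \<le> b"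
  shows "p dvd 2 ^ (b - a) - 1"
proof -
  have cop: "coprime p 2" using assms(1) by simp
  have "[b = a] (mod ord p 2)" using assms(2) cop order_divides_expdiff cong_sym by blast
  then have "ord p 2 dvd b - a" using assms(3) by (simp add: cong_altdef_nat)
  then have "[2 ^ (b - a) = 1] (mod p)" by (simp only: ord_divides)
  then show ?thesis by (subst (asm) cong_altdef_nat) auto
qed

lemma common_prime_divisor:
  fixes a b :: nat
  assumes "\<not> coprime a b"
  shows "\<exists>q. prime q \<and> q dvd a \<and> q dvd b"
proof -
  have "gcd a b \<noteq> 1" using assms by (metis coprime_iff_gcd_eq_1)
  then obtain q where "prime q" "q dvd gcd a b" using prime_factor_nat by blast
  then show ?thesis by auto
qed

text \<open>The order of choice matters. The \<open>c\<close> exponents serving the smooth part come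
  first; whatever they contribute modulo each large prime is then compensated by 1680 exponents that
  are trivial modulo the smooth part.\<close>

lemma mem_Cset_if_generic:
  fixes k y z m :: nat
  assumes k: "odd k" and y: "y \<ge> 4" and yz: "y \<le> z"
    and sqf: "\<And>p. prime p \<Longrightarrow> p > y \<Longrightarrow> \<not> p ^ 2 dvd k"
    and gcds: "\<And>p p' q. prime p \<Longrightarrow> prime p' \<Longrightarrow> p \<noteq> p' \<Longrightarrow> p dvd k \<Longrightarrow> p' dvd k \<Longrightarrow>
      prime q \<Longrightarrow> q > y \<Longrightarrow> q dvd p - 1 \<Longrightarrow> \<not> q dvd p' - 1"
    and good: "\<And>p. prime p \<Longrightarrow> p dvd k \<Longrightarrow> p > z \<Longrightarrow>
      \<exists>j\<ge>y\<^sup>2. p \<le> 2 ^ (40 * (j + 1)) \<and> good_prime y j p"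
    and smooth: "smooth_part z k \<le> 2 ^ (m - 1680)" "smooth_part z k < k"
    and m: "1680 \<le> m" "m \<le> 2 ^ y\<^sup>2"
  shows "k \<in> Cset m"
proof -
  have k0: "k > 0" using k by (auto intro: Nat.gr0I)
  have k1: "k > 1" using smooth(2) smooth_part_pos[of z k] by linarith
  have sqf_z: "\<not> p ^ 2 dvd k" if "prime p" "p > z" for p using sqf[of p] that yz by simp
  define c where "c = m - 1680"
  define n where "n = smooth_part z k"
  have n0: "n > 0" by (simp add: n_def smooth_part_pos)
  have nk: "n dvd k" unfolding n_def using k0 by (rule smooth_part_dvd)
  have oddn: "odd n" using nk k by (meson dvd_trans)
  define P where "P = {p. prime p \<and> p dvd k \<and> p > z}"
  have finP: "finite P" by (rule finite_subset[of _ "{..k}"]) (use k0 in \<open>auto simp: P_def dvd_imp_le\<close>)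
  have primeP: "prime p" and dvdP: "p dvd k" and gtP: "p > z" if "p \<in> P" for p using that by (simp_all add: P_def)
  have oddP: "odd p" if "p \<in> P" for p using dvdP[OF that] k by (meson dvd_trans)
  \<comment> \<open>A prime above \<open>z\<close> must exist, because the distinctness of the
    exponents will be read off modulo it.\<close>
  have "P \<noteq> {}"
  proof
    assume "P = {}"
    then have "int k dvd int n"
      by (intro dvd_by_smooth_part[OF k0, of z]) (auto simp: sqf_z n_def P_def)
    then have "k \<le> n" using n0 by (simp add: dvd_imp_le)
    then show False using smooth(2) by (simp add: n_def)
  qed
  then obtain p0 where p0: "p0 \<in> P" by blast
  have "\<exists>j. j \<ge> y\<^sup>2 \<and> p \<le> 2 ^ (40 * (j + 1)) \<and> good_prime y j p" if "p \<in> P" for p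
    using good[of p] that by (auto simp: P_def)
  then obtain j where j: "\<And>p. p \<in> P \<Longrightarrow> j p \<ge> y\<^sup>2 \<and> p \<le> 2 ^ (40 * (j p + 1)) \<and> good_prime y (j p) p" by metis
  have "16 \<le> y\<^sup>2" using power_mono[OF y, of 2] by simp
  then have j16: "j p \<ge> 16" if "p \<in> P" for p using j[OF that] by linarith
  define L where "L p = smooth_part y (p - 1)" for p
  define R where "R p = (p - 1) div L p" for p
  have pos: "p - 1 > 0" if "p \<in> P" for p using prime_gt_1_nat[OF primeP[OF that]] by simp
  have LR: "p - 1 = L p * R p" if "p \<in> P" for p
    using smooth_part_dvd[OF pos[OF that]] by (simp add: L_def R_def)
  have rough: "q > y \<and> q dvd p - 1" if "p \<in> P" "prime q" "q dvd R p" for p q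
    using prime_dvd_cofactor[OF pos[OF that(1)] that(2), of y] that(3) LR[OF that(1)]
    unfolding R_def L_def by (metis dvd_mult)
  have copL: "coprime (R p) (L p')" if "p \<in> P" for p p'
  proof (rule ccontr)
    assume "\<not> ?thesis"
    then obtain q where q: "prime q" "q dvd R p" "q dvd L p'" using common_prime_divisor by blast
    then show False using rough[OF that q(1,2)] prime_dvd_smooth_part[OF q(1) q(3)[unfolded L_def]] by simp
  qed
  have copR: "coprime (R p) (R p')" if "p \<in> P" "p' \<in> P" "p \<noteq> p'" for p p'
  proof (rule ccontr)
    assume "\<not> ?thesis"
    then obtain q where q: "prime q" "q dvd R p" "q dvd R p'" using common_prime_divisor by blast
    then show False
      using rough[OF that(1) q(1,2)] rough[OF that(2) q(1,3)] gcds[of p p' q] that by (simp add: P_def)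
  qed
  \<comment> \<open>A prime q > y dividing both cannot come from a square in \<open>n\<close>, so it
    divides p' - 1 for some prime p' dividing \<open>n\<close>; as p' <= z < p, the pair p, p'
    violates \<open>gcds\<close>.\<close>
  have copn: "coprime (R p) (totient n)" if p: "p \<in> P" for p
  proof (rule ccontr)
    assume "\<not> ?thesis"
    then obtain q where q: "prime q" "q dvd R p" "q dvd totient n" using common_prime_divisor by blast
    have qy: "q > y" "q dvd p - 1" using rough[OF p q(1,2)] by auto
    have "\<not> q ^ 2 dvd n" using sqf[OF q(1) qy(1)] nk dvd_trans by blast
    then obtain p' where p': "prime p'" "p' dvd n" "q dvd p' - 1" using prime_dvd_totient[OF q(1,3) n0] by blast
    have "p' \<le> z" using prime_dvd_smooth_part[OF p'(1)] p'(2) by (simp add: n_def)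
    then have "p \<noteq> p'" using gtP[OF p] by auto
    then show False using gcds[of p p' q] p' p q(1) qy nk dvd_trans by (auto simp: P_def)
  qed
  \<comment> \<open>The numbers \<open>L p\<close> and \<open>totient n\<close> need not be coprime
    to each other, so they are merged into one modulus, on which each exponent receives a single
    condition; only the \<open>R p\<close> carry separate conditions.\<close>
  define D where "D = totient n * (\<Prod>p\<in>P. L p)"
  have copD: "coprime (R p) D" if "p \<in> P" for p
    unfolding D_def using copn[OF that] copL[OF that] by (simp add: prod_coprime_right)
  have crt: "\<exists>e. [e = d] (mod D) \<and> (\<forall>p\<in>P. [e = g p] (mod R p))" for d and g :: "nat \<Rightarrow> nat"
  proof -
    \<comment> \<open>Index 0, which is not a prime, stands for the modulus
      \<open>D\<close>.\<close>
    have P0: "0 \<notin> P" using primeP not_prime_0 by blast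
    have "\<exists>e. \<forall>i\<in>insert 0 P. [e = (if i = 0 then d else g i)] (mod (if i = 0 then D else R i))"
    proof (rule chinese_remainder_nat)
      show "\<forall>i\<in>insert 0 P. \<forall>i'\<in>insert 0 P. i \<noteq> i' \<longrightarrow>
          coprime (if i = 0 then D else R i) (if i' = 0 then D else R i')"
        using copR copD P0 by (auto simp: coprime_commute)
    qed (use finP in simp)
    then obtain e where e: "\<And>i. i \<in> insert 0 P \<Longrightarrow> [e = (if i = 0 then d else g i)] (mod (if i = 0 then D else R i))" by blast
    have "[e = d] (mod D)" using e[of 0] by simp
    moreover have "[e = g p] (mod R p)" if "p \<in> P" for p
      using e[of p] that P0 by (metis insertCI)
    ultimately show ?thesis by blast
  qed
  define r :: int where "r = 2 ^ (k + m) - 1"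
  \<comment> \<open>The 1680 exponents reserved for the large primes will be 0 modulo
    \<open>D\<close>, hence contribute 1 each modulo \<open>n\<close>.\<close>
  obtain f where f: "[(\<Sum>i<c. 2 ^ f i) = r - 1680] (mod int n)"
    using every_residue_sum_of_powers_of_2[of n c] n0 smooth(1) unfolding n_def c_def by blast
  define W :: nat where "W = 1600 * 4 ^ j p0 + 80 * 2 ^ j p0"
  \<comment> \<open>Modulo \<open>L p\<close> these exponents equal f i, so their powers of 2 modulo
    p are not directly prescribed; the sets \<open>E p\<close> are chosen afterwards for what
    remains of \<open>r\<close>.\<close>
  have "\<exists>e. [e = f i] (mod D) \<and> (\<forall>p\<in>P. [e = L p * (W + i)] (mod R p))" for i
    by (rule crt)
  then obtain e2 where e2: "\<And>i. [e2 i = f i] (mod D)" "\<And>i p. p \<in> P \<Longrightarrow> [e2 i = L p * (W + i)] (mod R p)" by metis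
  have "\<exists>E. finite E \<and> card E = 1680 \<and> E \<subseteq> {..<1600 * 4 ^ j p + 80 * 2 ^ j p} \<and>
      [int (pow2_sum (L p) E) = r - (\<Sum>i<c. 2 ^ e2 i)] (mod int p)" if "p \<in> P" for p
    unfolding L_def using j[OF that] by (intro good_prime_sums j16 primeP oddP that) auto
  then obtain E where E: "\<And>p. p \<in> P \<Longrightarrow> finite (E p) \<and> card (E p) = 1680 \<and> E p \<subseteq> {..<1600 * 4 ^ j p + 80 * 2 ^ j p} \<and>
      [int (pow2_sum (L p) (E p)) = r - (\<Sum>i<c. 2 ^ e2 i)] (mod int p)" by metis
  have "\<exists>a. bij_betw a {..<1680::nat} (E p)" if "p \<in> P" for p
    using ex_bij_betw_nat_finite[of "E p"] E[OF that] by (simp add: atLeast0LessThan)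
  then obtain a where a: "\<And>p. p \<in> P \<Longrightarrow> bij_betw (a p) {..<1680::nat} (E p)" by metis
  \<comment> \<open>Being 0 modulo \<open>D\<close> agrees with being a multiple of
    \<open>L p\<close>, so together with the condition modulo \<open>R p\<close> it fixes the
    exponent as L p * a p i modulo p - 1.\<close>
  have "\<exists>e. [e = 0] (mod D) \<and> (\<forall>p\<in>P. [e = L p * a p i] (mod R p))" for i
    by (rule crt)
  then obtain e1 where e1: "\<And>i. [e1 i = 0] (mod D)" "\<And>i p. p \<in> P \<Longrightarrow> [e1 i = L p * a p i] (mod R p)" by metis
  define e where "e i = (if i < 1680 then e1 i else e2 (i - 1680))" for i
  have split: "(\<Sum>i<m. h (e i)) = (\<Sum>i<1680. h (e1 i)) + (\<Sum>i<c. h (e2 i))" for h :: "nat \<Rightarrow> int"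
  proof -
    have "(\<Sum>i<l + n. g i) = (\<Sum>i<l. g i) + (\<Sum>i<n. g (l + i))" for l n and g :: "nat \<Rightarrow> int"
      by (induction n) (simp_all add: add.assoc)
    from this[where l = 1680 and n = c and g = "\<lambda>i. h (e i)"]
    have "(\<Sum>i<1680 + c. h (e i)) = (\<Sum>i<1680. h (e1 i)) + (\<Sum>i<c. h (e2 i))"
      by (simp add: e_def)
    moreover have "1680 + c = m" using m by (simp add: c_def)
    ultimately show ?thesis by simp
  qed
  have totn: "totient n dvd D" by (simp add: D_def)
  have sum_n: "[(\<Sum>i<m. 2 ^ e i) = r] (mod int n)"
  proof -
    have "[(2::int) ^ e1 i = 2 ^ 0] (mod int n)" for i
      using e1(1)[of i] totn by (intro pow2_cong_totient[OF oddn]) (rule cong_dvd_modulus_nat)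
    then have "[(\<Sum>i<1680. (2::int) ^ e1 i) = (\<Sum>i<1680::nat. 1)] (mod int n)" by (intro cong_sum) simp
    moreover have "[(2::int) ^ e2 i = 2 ^ f i] (mod int n)" for i
      using e2(1)[of i] totn by (intro pow2_cong_totient[OF oddn]) (rule cong_dvd_modulus_nat)
    then have "[(\<Sum>i<c. (2::int) ^ e2 i) = (\<Sum>i<c. 2 ^ f i)] (mod int n)" by (intro cong_sum)
    then have "[(\<Sum>i<c. (2::int) ^ e2 i) = r - 1680] (mod int n)" using f by (rule cong_trans)
    ultimately have "[(\<Sum>i<1680. (2::int) ^ e1 i) + (\<Sum>i<c. 2 ^ e2 i) = (\<Sum>i<1680::nat. 1) + (r - 1680)] (mod int n)"
      by (rule cong_add)
    then show ?thesis unfolding split by simp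
  qed
  have sum_p: "[(\<Sum>i<m. 2 ^ e i) = r] (mod int p)" if p: "p \<in> P" for p
  proof -
    have "[(2::int) ^ e1 i = 2 ^ (L p * a p i)] (mod int p)" for i
    proof (rule pow2_cong_totient[OF oddP[OF p]])
      have "L p dvd D" unfolding D_def using p finP by (simp add: dvd_prodI dvd_mult)
      then have "[e1 i = 0] (mod L p)" using e1(1) cong_dvd_modulus_nat by blast
      moreover have "[L p * a p i = 0] (mod L p)" by (simp add: cong_0_iff)
      ultimately have "[e1 i = L p * a p i] (mod L p)" by (meson cong_sym cong_trans)
      then have "[e1 i = L p * a p i] (mod L p * R p)"
        using e1(2)[OF p, of i] copL[OF p, of p] by (intro coprime_cong_mult_nat) (auto simp: coprime_commute)
      then show "[e1 i = L p * a p i] (mod totient p)"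
        using LR[OF p] by (simp add: totient_prime[OF primeP[OF p]])
    qed
    then have "[(\<Sum>i<1680. (2::int) ^ e1 i) = (\<Sum>i<1680. 2 ^ (L p * a p i))] (mod int p)" by (intro cong_sum)
    also have "(\<Sum>i<1680. (2::int) ^ (L p * a p i)) = int (pow2_sum (L p) (E p))"
      using sum.reindex_bij_betw[OF a[OF p], of "\<lambda>x. (2::int) ^ (L p * x)"] by (simp add: pow2_sum_def)
    also have "[\<dots> = r - (\<Sum>i<c. 2 ^ e2 i)] (mod int p)" using E[OF p] by blast
    finally have "[(\<Sum>i<1680. (2::int) ^ e1 i) + (\<Sum>i<c. 2 ^ e2 i) = r - (\<Sum>i<c. 2 ^ e2 i) + (\<Sum>i<c. 2 ^ e2 i)] (mod int p)"
      by (rule cong_add) simp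
    then show ?thesis unfolding split by simp
  qed
  have sum_k: "[(\<Sum>i<m. 2 ^ e i) = r] (mod int k)"
    unfolding cong_iff_dvd_diff
  proof (rule dvd_by_smooth_part[OF k0 sqf_z])
    show "int (smooth_part z k) dvd (\<Sum>i<m. 2 ^ e i) - r"
      using sum_n by (simp add: n_def cong_iff_dvd_diff)
    show "int p dvd (\<Sum>i<m. 2 ^ e i) - r" if "prime p" "p dvd k" "p > z" for p
      using sum_p[of p] that by (simp add: P_def cong_iff_dvd_diff)
  qed
  \<comment> \<open>Modulo the single good prime \<open>p0\<close> the exponents are, up to the factor \<open>L p0\<close>, distinct and below the
    order of \<open>2 ^ L p0\<close>; this is why the last \<open>c\<close> of them were prescribed to be \<open>L p (W + i)\<close>.\<close>
  define x where "x i = (if i < 1680 then a p0 i else W + (i - 1680))" for i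
  have ex: "[e i = L p0 * x i] (mod R p0)" for i
    using e1(2)[OF p0, of i] e2(2)[OF p0, of "i - 1680"] by (cases "i < 1680") (simp_all only: e_def x_def if_True if_False)
  have aW: "a p0 i < W" if "i < 1680" for i
    using bij_betwE[OF a[OF p0]] E[OF p0] that unfolding W_def by (metis lessThan_iff subsetD)
  have xinj: "i = i'" if "i < m" "i' < m" "x i = x i'" for i i'
  proof -
    have "a p0 i = a p0 i' \<Longrightarrow> i < 1680 \<Longrightarrow> i' < 1680 \<Longrightarrow> i = i'"
      using bij_betw_imp_inj_on[OF a[OF p0]] by (auto dest: inj_onD)
    then show ?thesis using that aW[of i] aW[of i'] by (auto simp: x_def split: if_splits)
  qed
  have xless: "x i < 2 ^ (4 * j p0)" if "i < m" for i
  proof -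
    have J: "j p0 \<ge> y\<^sup>2" "j p0 \<ge> 16" using j[OF p0] j16[OF p0] by auto
    have "x i < W + m" using that aW[of i] m by (auto simp: x_def)
    moreover have "m \<le> 2 ^ j p0" by (rule le_trans[OF m(2) power_increasing[OF J(1)]]) simp
    moreover have "W + 2 ^ j p0 \<le> 2 ^ (4 * j p0)"
    proof -
      define t :: nat where "t = 2 ^ j p0"
      have t: "t \<ge> 65536" unfolding t_def using power_increasing[OF J(2), of "2::nat"] by simp
      have "W + t = 1600 * (t * t) + 81 * t" by (simp add: W_def t_def flip: power_mult_distrib)
      also have "\<dots> \<le> 1600 * (t * t) + 81 * (t * t)" using t by simp
      also have "\<dots> \<le> (t * t) * (t * t)" using t mult_mono[OF t t] by simp
      also have "\<dots> = 2 ^ (4 * j p0)" by (simp add: t_def flip: power_add)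
      finally show ?thesis by (simp add: t_def)
    qed
    ultimately show ?thesis by linarith
  qed
  \<comment> \<open>Reduction modulo \<open>totient k\<close> brings the exponents into the range
    allowed by \<open>Cset\<close>; this divisibility makes the reduction invisible modulo
    \<open>p0\<close>.\<close>
  have tot_ord: "ord p0 2 dvd totient k"
  proof -
    have "[2 ^ totient k = 1] (mod k)" using euler_theorem[of 2 k] k by simp
    then have "[2 ^ totient k = 1] (mod p0)" using dvdP[OF p0] cong_dvd_modulus_nat by blast
    then show ?thesis by (simp only: ord_divides)
  qed
  have inj: "inj_on (\<lambda>i. e i mod totient k) {..<m}"
  proof (rule inj_onI)
    fix i i' assume i: "i \<in> {..<m}" "i' \<in> {..<m}" "e i mod totient k = e i' mod totient k"
    then have "[e i = e i'] (mod ord p0 2)" using tot_ord by (metis cong_def cong_dvd_modulus_nat)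
    then have eq: "[2 ^ (L p0 * x i) = 2 ^ (L p0 * x i')] (mod p0)"
      using copL[OF p0, of p0] by (intro cong_mod_order_cancel[OF primeP oddP LR _ ex ex] p0) (auto simp: coprime_commute)
    have no: False if "u < v" "v < 2 ^ (4 * j p0)" "[2 ^ (L p0 * u) = 2 ^ (L p0 * v)] (mod p0)" for u v
    proof -
      have "p0 dvd 2 ^ (L p0 * v - L p0 * u) - 1"
        using that by (intro pow2_cong_imp_dvd oddP p0) auto
      then have "p0 dvd 2 ^ (L p0 * (v - u)) - 1" by (simp add: diff_mult_distrib2)
      moreover have "\<not> p0 dvd 2 ^ (L p0 * (v - u)) - 1"
        unfolding L_def using that j[OF p0] by (intro good_prime_order[where j = "j p0"]) auto
      ultimately show False by blast
    qed
    have "x i = x i'"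
      using no[of "x i" "x i'"] no[of "x i'" "x i"] eq xless[of i] xless[of i'] i cong_sym
      by (metis lessThan_iff linorder_neqE_nat)
    then show "i = i'" using xinj i by simp
  qed
  define J where "J = (\<lambda>i. e i mod totient k) ` {..<m}"
  have tk: "totient k > 0" "totient k < k" using k1 by (simp_all add: totient_less)
  have "J \<subseteq> {0..m + k - 2}"
  proof
    fix u assume "u \<in> J"
    then have "u < totient k" using tk by (auto simp: J_def)
    then show "u \<in> {0..m + k - 2}" using tk by simp
  qed
  moreover have "card J = m" unfolding J_def using inj by (simp add: card_image)
  moreover have "[2 ^ (k + m) - 1 = (\<Sum>j\<in>J. 2 ^ j)] (mod int k)"
  proof -
    have "(\<Sum>j\<in>J. (2::int) ^ j) = (\<Sum>i<m. 2 ^ (e i mod totient k))"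
      unfolding J_def by (subst sum.reindex[OF inj]) simp
    also have "[\<dots> = (\<Sum>i<m. 2 ^ e i)] (mod int k)"
      by (intro cong_sum pow2_cong_totient[OF k]) simp
    also note sum_k
    finally show ?thesis unfolding r_def by (rule cong_sym)
  qed
  ultimately show ?thesis using k k0 unfolding Cset_def by blast
qed

subsection \<open>Density of the exceptional sets\<close>

lemma card_square_prime_divisor_le:
  fixes y N :: nat
  assumes "y > 0"
  shows "real (card {k\<in>{1..N}. \<exists>p. prime p \<and> p > y \<and> p\<^sup>2 dvd k}) \<le> N * (2 / y)"
proof -
  have "{k\<in>{1..N}. \<exists>p. prime p \<and> p > y \<and> p\<^sup>2 dvd k} \<subseteq> {k\<in>{1..N}. \<exists>p\<in>{y..N}. p\<^sup>2 dvd k}"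
  proof
    fix k assume "k \<in> {k\<in>{1..N}. \<exists>p. prime p \<and> p > y \<and> p\<^sup>2 dvd k}"
    then obtain p where p: "1 \<le> k" "k \<le> N" "p > y" "p\<^sup>2 dvd k" by auto
    have "p \<le> p\<^sup>2" by (simp add: power2_eq_square)
    also have "\<dots> \<le> k" using p by (intro dvd_imp_le) auto
    finally show "k \<in> {k\<in>{1..N}. \<exists>p\<in>{y..N}. p\<^sup>2 dvd k}" using p by auto
  qed
  then have "card {k\<in>{1..N}. \<exists>p. prime p \<and> p > y \<and> p\<^sup>2 dvd k} \<le> card {k\<in>{1..N}. \<exists>p\<in>{y..N}. p\<^sup>2 dvd k}"
    by (rule card_mono[rotated]) simp
  then have "real (card {k\<in>{1..N}. \<exists>p. prime p \<and> p > y \<and> p\<^sup>2 dvd k}) \<le> real (card {k\<in>{1..N}. \<exists>p\<in>{y..N}. p\<^sup>2 dvd k})"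
    by simp
  also have "\<dots> \<le> N * (\<Sum>p=y..N. 1 / real (p\<^sup>2))"
    using assms by (intro card_some_divisor_le) auto
  also have "\<dots> \<le> N * (2 / y)"
    using sum_inverse_squares_le[of y N] assms by (intro mult_left_mono) auto
  finally show ?thesis .
qed

text \<open>Telescoping: for s = sqrt n and t = sqrt (n + 1), 2 / s - 2 / t = 2 / (s t (s + t)) >= 1
  / t^3.\<close>

lemma sum_three_halves_le:
  assumes "y \<ge> 1"
  shows "(\<Sum>q=Suc y..N. 1 / (real q * sqrt q)) \<le> 2 / sqrt y"
proof (cases "y \<le> N")
  case True
  have "(\<Sum>q=Suc y..N. 1 / (real q * sqrt q)) \<le> 2 / sqrt y - 2 / sqrt N"
    using True
  proof (induction N rule: dec_induct)
    case (step n)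
    define s t where "s = sqrt n" and "t = sqrt (Suc n)"
    have s: "s > 0" "s \<le> t" "t\<^sup>2 = s\<^sup>2 + 1" using step assms by (auto simp: s_def t_def)
    have t: "t > 0" using s by linarith
    have "(t - s) * (t + s) = 1" using s(3) by (simp add: power2_eq_square algebra_simps)
    then have ts: "t - s = 1 / (t + s)" using s t by (simp add: field_simps)
    have "2 / s - 2 / t = 2 * (t - s) / (s * t)" using s t by (simp add: field_simps)
    also have "\<dots> = 2 / (s * t * (t + s))" unfolding ts using s t by (simp add: field_simps)
    also have "\<dots> \<ge> 2 / (t * t * (t + t))"
      using s t by (intro divide_left_mono mult_mono mult_pos_pos add_mono) auto
    finally have "2 / (t * t * (t + t)) \<le> 2 / s - 2 / t" .
    moreover have "2 / (t * t * (t + t)) = 1 / (real (Suc n) * t)"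
    proof -
      have "t * t = real (Suc n)" by (simp add: t_def)
      moreover have "2 / (t * t * (t + t)) = 1 / (t * t * t)" using t by (simp add: field_simps)
      ultimately show ?thesis by simp
    qed
    ultimately have "1 / (real (Suc n) * sqrt (Suc n)) \<le> 2 / sqrt n - 2 / sqrt (Suc n)"
      by (simp add: s_def t_def)
    moreover have "(\<Sum>q=Suc y..Suc n. 1 / (real q * sqrt q)) = (\<Sum>q=Suc y..n. 1 / (real q * sqrt q)) + 1 / (real (Suc n) * sqrt (Suc n))"
      using step(1) by (intro sum.cl_ivl_Suc[THEN trans]) simp
    ultimately show ?case using step.IH by linarith
  qed simp
  moreover have "2 / sqrt (real N) \<ge> 0" by simp
  ultimately show ?thesis by linarith
qed simp

text \<open>For fixed q the pairs p, p' contribute at most N times the square of the sum of 1 / p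
  over primes 1 modulo q. That square decays fast enough in q for the tail beyond \<open>y\<close>
  to be small.\<close>

lemma card_common_prime_divisor_le:
  fixes y N J :: nat
  assumes y: "y \<ge> 3" and N: "N \<le> 2 ^ J" and J: "J \<ge> 1"
  shows "real (card {k\<in>{1..N}. \<exists>p p' q. prime p \<and> prime p' \<and> p \<noteq> p' \<and> p dvd k \<and> p' dvd k \<and>
      prime q \<and> q > y \<and> q dvd p - 1 \<and> q dvd p' - 1}) \<le> N * (18432 * (1 + ln J)\<^sup>2 / sqrt y)"
    (is "real (card ?S) \<le> _")
proof -
  define P where "P q = {p. prime p \<and> [p = 1] (mod q) \<and> p \<le> N}" for q
  define Q where "Q = {q\<in>{Suc y..N}. prime q}"
  define I where "I = Sigma Q (\<lambda>q. P q \<times> P q)"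
  define d where "d = (\<lambda>(q::nat, p::nat, p'::nat). p * p')"
  have finP: "finite (P q)" for q unfolding P_def by (rule finite_subset[of _ "{..N}"]) auto
  have finQ: "finite Q" by (simp add: Q_def)
  have finI: "finite I" using finP finQ by (simp add: I_def)
  have "?S \<subseteq> {k\<in>{1..N}. \<exists>i\<in>I. d i dvd k}"
  proof
    fix k assume "k \<in> ?S"
    then obtain p p' q where k: "1 \<le> k" "k \<le> N" and p: "prime p" "prime p'" "p \<noteq> p'" "p dvd k" "p' dvd k"
      and q: "prime q" "q > y" "q dvd p - 1" "q dvd p' - 1" by auto
    have "p \<le> N" "p' \<le> N" using k p by (auto dest: dvd_imp_le)
    moreover have "[p = 1] (mod q)" "[p' = 1] (mod q)"
      using q p prime_ge_1_nat by (metis cong_altdef_nat)+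
    moreover have "q \<le> N"
    proof -
      have "q \<le> p - 1" using q p prime_gt_1_nat[of p] by (intro dvd_imp_le) auto
      then show ?thesis using \<open>p \<le> N\<close> by linarith
    qed
    ultimately have "(q, p, p') \<in> I" using p q by (simp add: I_def P_def Q_def)
    moreover have "d (q, p, p') dvd k" using p by (simp add: d_def divides_mult primes_coprime)
    ultimately show "k \<in> {k\<in>{1..N}. \<exists>i\<in>I. d i dvd k}" using k by auto
  qed
  then have "card ?S \<le> card {k\<in>{1..N}. \<exists>i\<in>I. d i dvd k}" by (rule card_mono[rotated]) simp
  then have "real (card ?S) \<le> real (card {k\<in>{1..N}. \<exists>i\<in>I. d i dvd k})" by simp
  also have "\<dots> \<le> N * (\<Sum>i\<in>I. 1 / d i)"
    by (rule card_some_divisor_le[OF finI]) (auto simp: I_def d_def P_def prime_gt_0_nat)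
  also have "(\<Sum>i\<in>I. 1 / real (d i)) = (\<Sum>q\<in>Q. (\<Sum>p\<in>P q. 1 / real p)\<^sup>2)"
  proof -
    have "(\<Sum>q\<in>Q. (\<Sum>p\<in>P q. 1 / real p)\<^sup>2) = (\<Sum>q\<in>Q. \<Sum>v\<in>P q \<times> P q. 1 / real (d (q, v)))"
      by (intro sum.cong refl)
        (simp add: d_def power2_eq_square sum_product sum.cartesian_product case_prod_unfold)
    also have "\<dots> = (\<Sum>(q, v)\<in>I. 1 / real (d (q, v)))"
      unfolding I_def using finQ finP by (intro sum.Sigma) auto
    finally show ?thesis by (simp add: case_prod_unfold)
  qed
  also have "\<dots> \<le> (\<Sum>q\<in>Q. 9216 * (1 + ln J)\<^sup>2 * (1 / (real q * sqrt q)))"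
  proof (rule sum_mono)
    fix q assume q: "q \<in> Q"
    then have q3: "prime q" "q \<ge> 3" using y by (auto simp: Q_def)
    have lnJ: "ln J \<ge> 0" using J by simp
    have "(\<Sum>p\<in>P q. 1 / real p) \<le> 24 * ln q / q * (1 + ln J)"
      unfolding P_def by (rule sum_primes_progression_le[OF q3 N J])
    \<comment> \<open>The crude ln q <= 4 q^(1/4) produces the summable q^(-3/2). Constants: 24 * 4
      = 96, 96^2 = 9216, and the 2 of \<open>sum_three_halves_le\<close> makes 18432.\<close>
    also have "\<dots> \<le> 24 * (4 * sqrt (sqrt q)) / q * (1 + ln J)"
    proof (intro mult_right_mono divide_right_mono mult_left_mono)
      have "ln (sqrt (sqrt q)) \<le> sqrt (sqrt q) - 1" using q3 by (intro ln_le_minus_one) auto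
      moreover have "ln (sqrt (sqrt q)) = ln q / 4" using q3 by (simp add: ln_sqrt)
      ultimately show "ln q \<le> 4 * sqrt (sqrt q)" by linarith
    qed (use lnJ in auto)
    finally have "(\<Sum>p\<in>P q. 1 / real p)\<^sup>2 \<le> (96 * sqrt (sqrt q) / q * (1 + ln J))\<^sup>2"
      by (intro power_mono sum_nonneg) auto
    also have "\<dots> = 9216 * (1 + ln J)\<^sup>2 * (sqrt q / (real q)\<^sup>2)"
      by (simp add: power_mult_distrib power_divide)
    also have "sqrt q / (real q)\<^sup>2 = 1 / (real q * sqrt q)"
      using q3 by (simp add: field_simps power2_eq_square)
    finally show "(\<Sum>p\<in>P q. 1 / real p)\<^sup>2 \<le> 9216 * (1 + ln J)\<^sup>2 * (1 / (real q * sqrt q))" .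
  qed
  also have "\<dots> = 9216 * (1 + ln J)\<^sup>2 * (\<Sum>q\<in>Q. 1 / (real q * sqrt q))" by (simp add: sum_distrib_left)
  also have "\<dots> \<le> 9216 * (1 + ln J)\<^sup>2 * (\<Sum>q=Suc y..N. 1 / (real q * sqrt q))"
    by (intro mult_left_mono sum_mono2) (auto simp: Q_def)
  also have "\<dots> \<le> 9216 * (1 + ln J)\<^sup>2 * (2 / sqrt y)"
    using y by (intro mult_left_mono sum_three_halves_le) auto
  also have "\<dots> = 18432 * (1 + ln J)\<^sup>2 / sqrt y" by simp
  finally show ?thesis by (simp add: mult_left_mono)
qed

lemma card_bad_prime_divisor_le:
  "\<exists>K>0. \<forall>y N::nat. y > 0 \<longrightarrow>
    real (card {k\<in>{1..N}. \<exists>p j. prime p \<and> p dvd k \<and> j \<ge> y\<^sup>2 \<and> 2 ^ (40 * j) < p \<and> p \<le> 2 ^ (40 * (j + 1)) \<and> \<not> good_prime y j p}) \<le> N * (K / (real y)\<^sup>2)"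
proof -
  define B where "B y N = {p. prime p \<and> p \<le> N \<and> (\<exists>j\<ge>y\<^sup>2. 2 ^ (40 * j) < p \<and> p \<le> 2 ^ (40 * (j + 1)) \<and> \<not> good_prime y j p)}" for y N :: nat
  obtain K where K: "K > 0" "\<And>y N::nat. y > 0 \<Longrightarrow> (\<Sum>p\<in>B y N. 1 / real p) \<le> K / (real y)\<^sup>2"
    using sum_bad_primes_le unfolding B_def by blast
  have "real (card {k\<in>{1..N}. \<exists>p j. prime p \<and> p dvd k \<and> j \<ge> y\<^sup>2 \<and> 2 ^ (40 * j) < p \<and> p \<le> 2 ^ (40 * (j + 1)) \<and> \<not> good_prime y j p}) \<le> N * (K / (real y)\<^sup>2)"
    (is "real (card ?S) \<le> _") if y: "y > 0" for y N :: nat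
  proof -
    have "?S \<subseteq> {k\<in>{1..N}. \<exists>p\<in>B y N. p dvd k}"
    proof
      fix k assume "k \<in> ?S"
      then obtain p j where k: "k \<in> {1..N}" "prime p" "p dvd k" "j \<ge> y\<^sup>2" "2 ^ (40 * j) < p" "p \<le> 2 ^ (40 * (j + 1))" "\<not> good_prime y j p"
        by blast
      have "p \<le> k" using k(1,3) by (intro dvd_imp_le) auto
      then have "p \<le> N" using k(1) by simp
      then have "p \<in> B y N" using k(2,4-) unfolding B_def by blast
      then show "k \<in> {k\<in>{1..N}. \<exists>p\<in>B y N. p dvd k}" using k(1,3) by blast
    qed
    then have "card ?S \<le> card {k\<in>{1..N}. \<exists>p\<in>B y N. p dvd k}" by (rule card_mono[rotated]) simp
    then have "real (card ?S) \<le> real (card {k\<in>{1..N}. \<exists>p\<in>B y N. p dvd k})" by simp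
    also have "\<dots> \<le> N * (\<Sum>p\<in>B y N. 1 / real p)"
    proof (rule card_some_divisor_le)
      show "finite (B y N)" by (rule finite_subset[of _ "{..N}"]) (auto simp: B_def)
      show "p > 0" if "p \<in> B y N" for p using that by (auto simp: B_def prime_gt_0_nat)
    qed
    also have "\<dots> \<le> N * (K / (real y)\<^sup>2)" using K(2)[OF y] by (intro mult_left_mono) auto
    finally show ?thesis .
  qed
  then show ?thesis using K(1) by blast
qed

text \<open>A crude Mertens estimate: log2 p <= a for primes up to 2^a, and the sum of 1 / (p - 1)
  over them is at most the full harmonic sum, hence at most 1 + a.\<close>

lemma sum_log_smooth_part_le:
  fixes a N :: nat
  shows "(\<Sum>k=1..N. log 2 (smooth_part (2 ^ a) k)) \<le> N * (a * (1 + a))"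
proof -
  define P where "P = {p::nat. prime p \<and> p \<le> 2 ^ a}"
  have finP: "finite P" by (simp add: P_def finite_primes_le)
  have pos: "p > 1" if "p \<in> P" for p using that prime_gt_1_nat by (simp add: P_def)
  have "log 2 (smooth_part (2 ^ a) k) = (\<Sum>p\<in>P. real (multiplicity p k) * log 2 p)" for k
  proof -
    have "log 2 (smooth_part (2 ^ a) k) = (\<Sum>p\<in>P. log 2 (real p ^ multiplicity p k))"
      unfolding smooth_part_def P_def[symmetric] of_nat_prod log_def
      using pos finP by (subst ln_prod) (force simp: sum_divide_distrib)+
    also have "\<dots> = (\<Sum>p\<in>P. real (multiplicity p k) * log 2 p)"
    proof (rule sum.cong)
      fix p assume "p \<in> P"
      then show "log 2 (real p ^ multiplicity p k) = real (multiplicity p k) * log 2 p"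
        using pos[of p] by (simp add: log_nat_power)
    qed simp
    finally show ?thesis .
  qed
  then have "(\<Sum>k=1..N. log 2 (smooth_part (2 ^ a) k)) = (\<Sum>k=1..N. \<Sum>p\<in>P. real (multiplicity p k) * log 2 p)"
    by simp
  also have "\<dots> = (\<Sum>p\<in>P. (\<Sum>k=1..N. real (multiplicity p k)) * log 2 p)"
    by (subst sum.swap) (simp add: sum_distrib_right)
  also have "\<dots> \<le> (\<Sum>p\<in>P. N / (real p - 1) * a)"
  proof (intro sum_mono mult_mono sum_multiplicity_le)
    fix p assume p: "p \<in> P"
    have "real p \<le> real (2 ^ a)" using p unfolding P_def by (intro of_nat_mono) simp
    then show "log 2 p \<le> a" using pos[OF p] by (simp add: log_le_iff powr_realpow)
    show "0 \<le> log 2 (real p)" using pos[OF p] by simp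
    show "0 \<le> N / (real p - 1)" using pos[OF p] by simp
    show "prime p" using p by (simp add: P_def)
  qed
  also have "\<dots> = N * (a * (\<Sum>p\<in>P. 1 / (real p - 1)))" by (simp add: sum_distrib_left mult.commute)
  also have "(\<Sum>p\<in>P. 1 / (real p - 1)) = (\<Sum>i\<in>(\<lambda>p. p - 1) ` P. 1 / real i)"
  proof (subst sum.reindex)
    show "inj_on (\<lambda>p. p - 1) P" using pos by (intro inj_onI) (metis One_nat_def Suc_pred less_trans zero_less_one)
    show "(\<Sum>p\<in>P. 1 / (real p - 1)) = sum ((\<lambda>i. 1 / real i) \<circ> (\<lambda>p. p - 1)) P"
      using pos by (intro sum.cong) (auto simp: of_nat_diff less_imp_le)
  qed
  also have "\<dots> \<le> (\<Sum>i=1..2 ^ a. 1 / real i)"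
  proof (rule sum_mono2)
    show "(\<lambda>p. p - 1) ` P \<subseteq> {1..2 ^ a}"
    proof
      fix i assume "i \<in> (\<lambda>p. p - 1) ` P"
      then obtain p where "p \<in> P" "i = p - 1" by blast
      then show "i \<in> {1..2 ^ a}" using pos[of p] unfolding P_def atLeastAtMost_iff mem_Collect_eq by linarith
    qed
  qed auto
  also have "\<dots> \<le> 1 + ln (real (2 ^ a))" by (rule harmonic_le) simp
  also have "ln (real (2 ^ a)) \<le> a"
    using ln_2_less_1 by (simp add: ln_realpow mult_left_le)
  finally show ?thesis by (simp add: mult_left_mono distrib_left)
qed

text \<open>Markov's inequality for the binary logarithm of the smooth part.\<close>

lemma card_smooth_part_greater_le:
  fixes a b N :: nat
  assumes "b > 0"
  shows "real (card {k\<in>{1..N}. smooth_part (2 ^ a) k > 2 ^ b}) \<le> N * (a * (1 + a) / b)"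
proof -
  define S where "S = {k\<in>{1..N}. smooth_part (2 ^ a) k > 2 ^ b}"
  have nonneg: "log 2 (smooth_part (2 ^ a) k) \<ge> 0" for k
    using smooth_part_pos[of "2 ^ a" k] by (simp add: Suc_le_eq)
  have "b * real (card S) = (\<Sum>k\<in>S. real b)" by simp
  also have "\<dots> \<le> (\<Sum>k\<in>S. log 2 (smooth_part (2 ^ a) k))"
  proof (rule sum_mono)
    fix k assume "k \<in> S"
    then have "real (2 ^ b) \<le> real (smooth_part (2 ^ a) k)" unfolding S_def by (intro of_nat_mono) simp
    then have "2 powr b \<le> real (smooth_part (2 ^ a) k)" by (simp add: powr_realpow)
    then show "real b \<le> log 2 (smooth_part (2 ^ a) k)"
      using smooth_part_pos[of "2 ^ a" k] by (simp add: le_log_iff)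
  qed
  also have "\<dots> \<le> (\<Sum>k=1..N. log 2 (smooth_part (2 ^ a) k))"
    using nonneg by (intro sum_mono2) (auto simp: S_def)
  also have "\<dots> \<le> N * (a * (1 + a))" by (rule sum_log_smooth_part_le)
  finally show ?thesis using assms by (simp add: S_def field_simps)
qed

text \<open>The cutoff at sqrt N serves twice: it lets \<open>\<mu> k\<close> be bounded below in
  terms of N, and it forces a smooth part of size at most 2^(y^5) to be smaller than
  \<open>k\<close>.\<close>

lemma card_not_mem_Cset_le:
  "\<exists>K>0. \<forall>(y::nat) (J::nat) (N::nat) \<mu>. y \<ge> 4 \<longrightarrow> J \<ge> 1 \<longrightarrow> N \<le> 2 ^ J \<longrightarrow> 2 ^ y ^ 5 \<le> sqrt N \<longrightarrow>
     (\<forall>k\<in>{1..N}. sqrt N < k \<longrightarrow> y ^ 5 + 1680 \<le> \<mu> k \<and> \<mu> k \<le> 2 ^ y\<^sup>2) \<longrightarrow>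
     real (card {k\<in>{1..N}. odd k \<and> sqrt N < k \<and> k \<notin> Cset (\<mu> k)})
       \<le> N * (1642 / y + 18432 * (1 + ln J)\<^sup>2 / sqrt y + K / (real y)\<^sup>2)"
proof -
  define X3 where "X3 y N = {k\<in>{1..N}. \<exists>p j. prime p \<and> p dvd k \<and> j \<ge> y\<^sup>2 \<and> 2 ^ (40 * j) < p \<and> p \<le> 2 ^ (40 * (j + 1)) \<and> \<not> good_prime y j p}" for y N :: nat
  obtain K where K: "K > 0" "\<And>y N::nat. y > 0 \<Longrightarrow> real (card (X3 y N)) \<le> N * (K / (real y)\<^sup>2)"
    using card_bad_prime_divisor_le unfolding X3_def by blast
  have "real (card {k\<in>{1..N}. odd k \<and> sqrt N < k \<and> k \<notin> Cset (\<mu> k)})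
      \<le> N * (1642 / y + 18432 * (1 + ln J)\<^sup>2 / sqrt y + K / (real y)\<^sup>2)"
    if y: "y \<ge> 4" and J: "J \<ge> 1" "N \<le> 2 ^ J" and b: "2 ^ y ^ 5 \<le> sqrt N"
      and \<mu>: "\<And>k. k \<in> {1..N} \<Longrightarrow> sqrt N < k \<Longrightarrow> y ^ 5 + 1680 \<le> \<mu> k \<and> \<mu> k \<le> 2 ^ y\<^sup>2"
    for y J N :: nat and \<mu>
  proof -
    \<comment> \<open>The 40 matches the intervals (2^(40 j), 2^(40 (j + 1))]: a prime above 2^a
      lies in one with j >= y^2.\<close>
    define a where "a = 40 * y\<^sup>2"
    define X where "X = {k\<in>{1..N}. odd k \<and> sqrt N < k \<and> k \<notin> Cset (\<mu> k)}"
    define X1 where "X1 = {k\<in>{1..N}. \<exists>p. prime p \<and> p > y \<and> p\<^sup>2 dvd k}"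
    define X2 where "X2 = {k\<in>{1..N}. \<exists>p p' q. prime p \<and> prime p' \<and> p \<noteq> p' \<and> p dvd k \<and> p' dvd k \<and>
      prime q \<and> q > y \<and> q dvd p - 1 \<and> q dvd p' - 1}"
    define X4 where "X4 = {k\<in>{1..N}. smooth_part (2 ^ a) k > 2 ^ y ^ 5}"
    have y0: "y > 0" "y ^ 5 > 0" using y by auto
    have "X \<subseteq> X1 \<union> X2 \<union> X3 y N \<union> X4"
    proof (rule subsetI, rule ccontr)
      fix k assume kX: "k \<in> X" and not: "k \<notin> X1 \<union> X2 \<union> X3 y N \<union> X4"
      have k: "k \<in> {1..N}" "odd k" "sqrt N < k" "k \<notin> Cset (\<mu> k)" using kX by (auto simp: X_def)
      have not1: "\<not> (\<exists>p. prime p \<and> p > y \<and> p\<^sup>2 dvd k)" using not k(1) unfolding X1_def by blast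
      have not2: "\<not> (\<exists>p p' q. prime p \<and> prime p' \<and> p \<noteq> p' \<and> p dvd k \<and> p' dvd k \<and>
          prime q \<and> q > y \<and> q dvd p - 1 \<and> q dvd p' - 1)" using not k(1) unfolding X2_def by blast
      have not3: "\<not> (\<exists>p j. prime p \<and> p dvd k \<and> j \<ge> y\<^sup>2 \<and> 2 ^ (40 * j) < p \<and> p \<le> 2 ^ (40 * (j + 1)) \<and> \<not> good_prime y j p)"
        using not k(1) unfolding X3_def by blast
      have not4: "smooth_part (2 ^ a) k \<le> 2 ^ y ^ 5" using not k(1) unfolding X4_def by (simp add: not_less)
      have "k \<in> Cset (\<mu> k)"
      proof (rule mem_Cset_if_generic[where y = y and z = "2 ^ a"])
        have "y \<le> a" by (simp add: a_def power2_eq_square)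
        also have "a < 2 ^ a" by (rule less_exp)
        finally show "y \<le> 2 ^ a" by simp
        show "\<exists>j\<ge>y\<^sup>2. p \<le> 2 ^ (40 * (j + 1)) \<and> good_prime y j p" if p: "prime p" "p dvd k" "p > 2 ^ a" for p
        proof -
          \<comment> \<open>\<open>p - 1\<close> instead of p, because the intervals are open on the
            left and closed on the right.\<close>
          have "\<exists>j. (2 ^ 40) ^ j \<le> p - 1 \<and> p - 1 < (2 ^ 40) ^ (j + 1)"
            using prime_gt_1_nat[OF p(1)] by (intro ex_power_ivl1) auto
          then obtain j where "(2 ^ 40) ^ j \<le> p - 1" "p - 1 < (2 ^ 40) ^ (j + 1)" by blast
          then have j1: "2 ^ (40 * j) \<le> p - 1" and j2: "p - 1 < 2 ^ (40 * (j + 1))"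
            by (simp_all only: power_mult)
          have j: "2 ^ (40 * j) < p" "p \<le> 2 ^ (40 * (j + 1))"
            using j1 j2 prime_gt_1_nat[OF p(1)] by linarith+
          have "(2::nat) ^ a < 2 ^ (40 * (j + 1))" using p(3) j(2) by linarith
          then have "40 * y\<^sup>2 < 40 * (j + 1)" unfolding a_def by (rule power_less_imp_less_exp[rotated]) simp
          then have "y\<^sup>2 \<le> j" by simp
          then show ?thesis using not3 p j by blast
        qed
        have mu: "y ^ 5 + 1680 \<le> \<mu> k" "\<mu> k \<le> 2 ^ y\<^sup>2" using \<mu>[OF k(1,3)] by auto
        then show "1680 \<le> \<mu> k" "\<mu> k \<le> 2 ^ y\<^sup>2" by auto
        have "(2::nat) ^ y ^ 5 \<le> 2 ^ (\<mu> k - 1680)" using mu(1) by (intro power_increasing) auto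
        then show "smooth_part (2 ^ a) k \<le> 2 ^ (\<mu> k - 1680)" using not4 by (rule order_trans[rotated])
        have "real (smooth_part (2 ^ a) k) \<le> real (2 ^ y ^ 5)" using not4 by (rule of_nat_mono)
        also have "\<dots> = 2 ^ y ^ 5" by (simp only: of_nat_power of_nat_numeral)
        also have "\<dots> < real k" using b k(3) by linarith
        finally show "smooth_part (2 ^ a) k < k" by (simp only: of_nat_less_iff)
      qed (use not1 not2 k y in blast)+
      then show False using k(4) by blast
    qed
    moreover have "finite X1" "finite X2" "finite (X3 y N)" "finite X4" by (simp_all add: X1_def X2_def X3_def X4_def)
    ultimately have "card X \<le> card (X1 \<union> X2 \<union> X3 y N \<union> X4)" by (intro card_mono) auto
    then have "card X \<le> card X1 + card X2 + card (X3 y N) + card X4"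
      using card_Un_le[of "X1 \<union> X2 \<union> X3 y N" X4] card_Un_le[of "X1 \<union> X2" "X3 y N"] card_Un_le[of X1 X2] by linarith
    moreover have "real (card X1) \<le> N * (2 / y)" unfolding X1_def using y0(1) by (rule card_square_prime_divisor_le)
    moreover have "real (card X2) \<le> N * (18432 * (1 + ln J)\<^sup>2 / sqrt y)"
      unfolding X2_def using y J by (intro card_common_prime_divisor_le) auto
    moreover have "real (card (X3 y N)) \<le> N * (K / (real y)\<^sup>2)" using y0(1) by (rule K(2))
    moreover have "real (card X4) \<le> N * (1640 / y)"
    proof -
      have "real (card X4) \<le> N * (a * (1 + a) / real (y ^ 5))"
        unfolding X4_def using y0(2) by (rule card_smooth_part_greater_le)
      \<comment> \<open>The numerator has order y^4; the threshold \<open>2 ^ y ^ 5\<close> is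
        chosen to leave one factor 1 / y. With the 2 / y from squares this makes 1642 / y.\<close>
      also have "a * (1 + a) / real (y ^ 5) \<le> 1640 / y"
      proof -
        have "real a * (1 + real a) = 40 * real y ^ 2 + 1600 * real y ^ 4"
          by (simp add: a_def distrib_left power2_eq_square power4_eq_xxxx)
        also have "\<dots> \<le> 1640 * real y ^ 4"
          using power_increasing[of 2 4 "real y"] y by simp
        finally have "real a * (1 + real a) / real y ^ 5 \<le> 1640 * real y ^ 4 / real y ^ 5"
          by (rule divide_right_mono) simp
        also have "\<dots> = 1640 / y" using y0 by (simp add: power_numeral_reduce)
        finally show ?thesis by (simp add: distrib_left)
      qed
      finally show ?thesis by (simp add: mult_left_mono)
    qed
    ultimately have "real (card X) \<le> N * (2 / y) + N * (18432 * (1 + ln J)\<^sup>2 / sqrt y) + N * (K / (real y)\<^sup>2) + N * (1640 / y)"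
      by linarith
    also have "\<dots> = N * (2 / y + 18432 * (1 + ln J)\<^sup>2 / sqrt y + K / (real y)\<^sup>2 + 1640 / y)"
      by (simp only: distrib_left)
    also have "2 / y + 18432 * (1 + ln J)\<^sup>2 / sqrt y + K / (real y)\<^sup>2 + 1640 / y = 1642 / y + 18432 * (1 + ln J)\<^sup>2 / sqrt y + K / (real y)\<^sup>2"
      using y0(1) by (simp add: field_simps)
    finally show ?thesis by (simp only: X_def)
  qed
  then show ?thesis using K(1) by blast
qed

section \<open>Size of \<open>mfun\<close>, choice of parameters and the limit\<close>

lemma plog_mono: "x \<le> y \<Longrightarrow> 0 < x \<Longrightarrow> plog x \<le> plog y"
  unfolding plog_def by (intro max.mono ln_mono) auto

lemma plog_ge_1: "plog x \<ge> 1"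
  by (simp add: plog_def)

lemma plog3_mono:
  assumes "x \<le> y" "0 < x"
  shows "plog (plog (plog x)) \<le> plog (plog (plog y))"
  by (intro plog_mono assms) (use plog_ge_1 less_le_trans zero_less_one in blast)+

lemma eventually_plog3: "eventually (\<lambda>x. plog (plog (plog x)) = ln (ln (ln x))) at_top"
proof -
  have "eventually (\<lambda>x::real. ln x \<ge> 1 \<and> ln (ln x) \<ge> 1 \<and> ln (ln (ln x)) \<ge> 1) at_top"
    by (intro eventually_conj; real_asymp)
  then show ?thesis by eventually_elim (simp add: plog_def)
qed

lemma mfun_bounds:
  assumes "0 < a" "a \<le> real k" "real k \<le> b"
  shows "exp (4000 * plog (plog (plog a)) ^ 3) - 1 \<le> mfun k" "mfun k \<le> exp (4000 * plog (plog (plog b)) ^ 3)"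
proof -
  define g where "g x = exp (4000 * plog (plog (plog x)) ^ 3)" for x
  have mono: "g x \<le> g x'" if "x \<le> x'" "0 < x" for x x'
  proof -
    have "0 \<le> plog (plog (plog x))" using plog_ge_1[of "plog (plog x)"] by linarith
    then show ?thesis unfolding g_def using plog3_mono[OF that] by (simp add: power_mono)
  qed
  have "0 \<le> g k" by (simp add: g_def)
  then have "real (mfun k) = of_int \<lfloor>g k\<rfloor>" unfolding mfun_def g_def[symmetric] by simp
  then have "g k - 1 \<le> mfun k" "mfun k \<le> g k" by linarith+
  moreover have "g a \<le> g k" "g k \<le> g b" using assms by (auto intro!: mono)
  ultimately show "exp (4000 * plog (plog (plog a)) ^ 3) - 1 \<le> mfun k" "mfun k \<le> exp (4000 * plog (plog (plog b)) ^ 3)"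
    unfolding g_def by linarith+
qed

lemma card_odd: "card {k\<in>{1..N}. odd k} = (N + 1) div 2"
proof (induction N)
  case (Suc N)
  have "{k\<in>{1..Suc N}. odd k} = {k\<in>{1..N}. odd k} \<union> (if odd (Suc N) then {Suc N} else {})"
    by (auto simp: le_Suc_eq)
  then show ?case using Suc by (auto simp: card_insert_if)
qed simp

lemma card_exceptional_le:
  "\<exists>K>0. eventually (\<lambda>N. real (card {k\<in>{1..N}. odd k \<and> sqrt N < k \<and> k \<notin> Cset (mfun k)}) \<le>
     N * (1642 / (ln (ln N) ^ 6 - 1) + 18432 * (1 + 2 * ln (ln N))\<^sup>2 / sqrt (ln (ln N) ^ 6 - 1)
       + K / (ln (ln N) ^ 6 - 1)\<^sup>2)) sequentially"
proof -
  obtain K where K: "K > 0" and bound: "\<And>(y::nat) (J::nat) (N::nat) \<mu>. y \<ge> 4 \<Longrightarrow> J \<ge> 1 \<Longrightarrow> N \<le> 2 ^ J \<Longrightarrow> 2 ^ y ^ 5 \<le> sqrt N \<Longrightarrow>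
     (\<And>k. k \<in> {1..N} \<Longrightarrow> sqrt N < k \<Longrightarrow> y ^ 5 + 1680 \<le> \<mu> k \<and> \<mu> k \<le> 2 ^ y\<^sup>2) \<Longrightarrow>
     real (card {k\<in>{1..N}. odd k \<and> sqrt N < k \<and> k \<notin> Cset (\<mu> k)})
       \<le> N * (1642 / y + 18432 * (1 + ln J)\<^sup>2 / sqrt y + K / (real y)\<^sup>2)"
    using card_not_mem_Cset_le by blast
  \<comment> \<open>(ln ln N)^30 dominates y^5; 1682 is 1680 plus 1 for the floor in
    \<open>mfun\<close>, with 1 to spare.\<close>
  have ev1: "eventually (\<lambda>N::nat. (ln (ln (real N))) ^ 30 + 1682 \<le> exp (4000 * (ln (ln (ln (sqrt (real N))))) ^ 3)) sequentially"
    by real_asymp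
  have ev2: "eventually (\<lambda>N::nat. exp (4000 * (ln (ln (ln (real N)))) ^ 3) \<le> 2 powr (ln (ln (real N)) ^ 6 - 1)) sequentially"
    by real_asymp
  have ev3: "eventually (\<lambda>N::nat. 2 powr (ln (ln (real N)) ^ 30) \<le> sqrt (real N)) sequentially"
    by real_asymp
  have ev4: "eventually (\<lambda>N::nat. real N \<le> 2 powr ((ln (real N))\<^sup>2 - 1)) sequentially"
    by real_asymp
  have ev5: "eventually (\<lambda>N::nat. (ln (real N))\<^sup>2 \<ge> 2) sequentially"
    by real_asymp
  have ev6: "eventually (\<lambda>N::nat. ln (ln (real N)) ^ 6 \<ge> 5) sequentially"
    by real_asymp
  have ev7: "eventually (\<lambda>N::nat. ln (real N) \<ge> 1) sequentially"
    by real_asymp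
  have ev8: "eventually (\<lambda>N::nat. plog (plog (plog (sqrt (real N)))) = ln (ln (ln (sqrt (real N))))) sequentially"
    by (rule eventually_compose_filterlim[OF eventually_plog3]) real_asymp
  have ev9: "eventually (\<lambda>N::nat. plog (plog (plog (real N))) = ln (ln (ln (real N)))) sequentially"
    by (rule eventually_compose_filterlim[OF eventually_plog3]) real_asymp
  have "eventually (\<lambda>N. real (card {k\<in>{1..N}. odd k \<and> sqrt N < k \<and> k \<notin> Cset (mfun k)}) \<le>
     N * (1642 / (ln (ln N) ^ 6 - 1) + 18432 * (1 + 2 * ln (ln N))\<^sup>2 / sqrt (ln (ln N) ^ 6 - 1)
       + K / (ln (ln N) ^ 6 - 1)\<^sup>2)) sequentially"
    using ev1 ev2 ev3 ev4 ev5 ev6 ev7 ev8 ev9 eventually_gt_at_top[of 0]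
  proof eventually_elim
    case (elim N)
    define l where "l = ln (ln (real N))"
    \<comment> \<open>The power 6 makes sqrt y about (ln ln N)^3, which beats the (ln ln N)^2 in the
      count of common prime divisors.\<close>
    define y where "y = nat \<lfloor>l ^ 6\<rfloor>"
    \<comment> \<open>A generous substitute for log2 N that costs only a factor 2 in
      \<open>ln J\<close>.\<close>
    define J where "J = nat \<lfloor>(ln (real N))\<^sup>2\<rfloor>"
    have l0: "l \<ge> 0" unfolding l_def using elim(7) by simp
    have l6: "l ^ 6 \<ge> 5" using elim(6) by (simp add: l_def)
    have y_le: "real y \<le> l ^ 6" and y_ge: "l ^ 6 - 1 \<le> real y" unfolding y_def using l6 by linarith+
    have J_le: "real J \<le> (ln (real N))\<^sup>2" and J_ge: "(ln (real N))\<^sup>2 - 1 \<le> real J" unfolding J_def using elim(5) by linarith+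
    have y4: "y \<ge> 4" using y_ge l6 by linarith
    have J1: "J \<ge> 1" using J_ge elim(5) by linarith
    have y5: "real (y ^ 5) \<le> l ^ 30"
    proof -
      have "real y ^ 5 \<le> (l ^ 6) ^ 5" using y_le by (intro power_mono) auto
      then show ?thesis by (simp flip: power_mult)
    qed
    have "real N \<le> 2 powr real J" using elim(4) J_ge by (meson order_trans powr_mono one_le_numeral)
    then have "real N \<le> real (2 ^ J)" by (simp add: powr_realpow)
    then have NJ: "N \<le> 2 ^ J" by (simp only: of_nat_le_iff)
    have "2 powr real (y ^ 5) \<le> 2 powr (l ^ 30)" using y5 by (intro powr_mono) auto
    then have yN: "2 ^ y ^ 5 \<le> sqrt N" using elim(3) unfolding l_def by (simp only: powr_realpow zero_less_numeral)
    have mu: "y ^ 5 + 1680 \<le> mfun k \<and> mfun k \<le> 2 ^ y\<^sup>2" if k: "k \<in> {1..N}" "sqrt N < k" for k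
    proof
      have "exp (4000 * plog (plog (plog (sqrt N))) ^ 3) - 1 \<le> mfun k"
        using k elim(10) by (intro mfun_bounds(1)[where b = N]) auto
      then have "real (y ^ 5) + 1680 \<le> real (mfun k)" using elim(1,8) y5 unfolding l_def by simp
      then show "y ^ 5 + 1680 \<le> mfun k" by linarith
      have "real (mfun k) \<le> exp (4000 * plog (plog (plog (real N))) ^ 3)"
        using k by (intro mfun_bounds(2)[where a = 1]) auto
      also have "\<dots> \<le> 2 powr (l ^ 6 - 1)" using elim(2,9) by (simp add: l_def)
      also have "\<dots> \<le> 2 powr real (y\<^sup>2)"
      proof (rule powr_mono)
        have "y * 1 \<le> y * y" using y4 by (intro mult_left_mono) auto
        then have "real y \<le> real (y\<^sup>2)" by (simp only: power2_eq_square mult_1_right of_nat_le_iff)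
        moreover have "y \<ge> l ^ 6 - 1" by (rule y_ge)
        ultimately show "l ^ 6 - 1 \<le> real (y\<^sup>2)" by linarith
      qed simp
      also have "2 powr real (y\<^sup>2) = real (2 ^ y\<^sup>2)" by (subst powr_realpow) simp_all
      finally show "mfun k \<le> 2 ^ y\<^sup>2" by (simp only: of_nat_le_iff)
    qed
    have "real (card {k\<in>{1..N}. odd k \<and> sqrt N < k \<and> k \<notin> Cset (mfun k)})
       \<le> N * (1642 / y + 18432 * (1 + ln J)\<^sup>2 / sqrt y + K / (real y)\<^sup>2)"
      using bound[OF y4 J1 NJ yN mu] .
    also have "\<dots> \<le> N * (1642 / (l ^ 6 - 1) + 18432 * (1 + 2 * l)\<^sup>2 / sqrt (l ^ 6 - 1) + K / (l ^ 6 - 1)\<^sup>2)"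
    proof (intro mult_left_mono add_mono)
      have pos: "0 < l ^ 6 - 1" using l6 by linarith
      show "1642 / real y \<le> 1642 / (l ^ 6 - 1)" using pos y_ge by (intro divide_left_mono) auto
      show "K / (real y)\<^sup>2 \<le> K / (l ^ 6 - 1)\<^sup>2"
        using pos y_ge y4 K by (intro divide_left_mono power_mono mult_pos_pos) auto
      have "ln (real J) \<le> ln ((ln (real N))\<^sup>2)" using J_le J1 by (intro ln_mono) auto
      also have "\<dots> = 2 * l" using elim(7) by (simp add: l_def ln_realpow)
      finally have "(1 + ln (real J))\<^sup>2 \<le> (1 + 2 * l)\<^sup>2" using J1 by (intro power_mono) auto
      then show "18432 * (1 + ln (real J))\<^sup>2 / sqrt (real y) \<le> 18432 * (1 + 2 * l)\<^sup>2 / sqrt (l ^ 6 - 1)"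
        using pos y_ge by (intro frac_le mult_left_mono real_sqrt_le_mono real_sqrt_gt_zero mult_nonneg_nonneg) auto
    qed simp
    finally show ?case unfolding l_def .
  qed
  then show ?thesis using K by blast
qed

theorem mainTheorem10:
  shows "(\<lambda>N::nat. real (card {k\<in>{1..N}. odd k \<and> k \<in> Cset (mfun k)}) / real N)
           \<longlonglongrightarrow> 1 / 2"
proof -
  obtain K where exceptional: "eventually (\<lambda>N. real (card {k\<in>{1..N}. odd k \<and> sqrt N < k \<and> k \<notin> Cset (mfun k)}) \<le>
     N * (1642 / (ln (ln N) ^ 6 - 1) + 18432 * (1 + 2 * ln (ln N))\<^sup>2 / sqrt (ln (ln N) ^ 6 - 1)
       + K / (ln (ln N) ^ 6 - 1)\<^sup>2)) sequentially"
    using card_exceptional_le by blast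
  \<comment> \<open>The last term pays for the k up to sqrt N, which \<open>exceptional\<close>
    leaves aside.\<close>
  define f where "f N = 1642 / (ln (ln (real N)) ^ 6 - 1) + 18432 * (1 + 2 * ln (ln (real N)))\<^sup>2 / sqrt (ln (ln (real N)) ^ 6 - 1)
       + K / (ln (ln (real N)) ^ 6 - 1)\<^sup>2 + 1 / sqrt (real N)" for N :: nat
  define A where "A N = real (card {k\<in>{1..N}. odd k \<and> k \<in> Cset (mfun k)})" for N
  have lower: "eventually (\<lambda>N. 1 / 2 - f N \<le> A N / N) sequentially"
    using exceptional eventually_gt_at_top[of 0]
  proof eventually_elim
    case (elim N)
    let ?B = "{k\<in>{1..N}. odd k \<and> sqrt N < k \<and> k \<notin> Cset (mfun k)}"
    let ?S = "{1..nat \<lfloor>sqrt N\<rfloor>}"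
    have "{k\<in>{1..N}. odd k} \<subseteq> {k\<in>{1..N}. odd k \<and> k \<in> Cset (mfun k)} \<union> ?B \<union> ?S"
    proof
      fix k assume k: "k \<in> {k\<in>{1..N}. odd k}"
      show "k \<in> {k\<in>{1..N}. odd k \<and> k \<in> Cset (mfun k)} \<union> ?B \<union> ?S"
      proof (cases "sqrt N < k")
        case False
        then have "k \<le> nat \<lfloor>sqrt N\<rfloor>" by (intro le_nat_floor) simp
        then show ?thesis using k by simp
      qed (use k in auto)
    qed
    then have "card {k\<in>{1..N}. odd k} \<le> card ({k\<in>{1..N}. odd k \<and> k \<in> Cset (mfun k)} \<union> ?B \<union> ?S)"
      by (intro card_mono) auto
    then have "card {k\<in>{1..N}. odd k} \<le> card {k\<in>{1..N}. odd k \<and> k \<in> Cset (mfun k)} + card ?B + card ?S"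
      using card_Un_le[of "{k\<in>{1..N}. odd k \<and> k \<in> Cset (mfun k)} \<union> ?B" ?S]
        card_Un_le[of "{k\<in>{1..N}. odd k \<and> k \<in> Cset (mfun k)}" ?B] by linarith
    then have "real (card {k\<in>{1..N}. odd k}) \<le> A N + real (card ?B) + real (card ?S)"
      unfolding A_def by linarith
    moreover have "real N / 2 \<le> real (card {k\<in>{1..N}. odd k})" unfolding card_odd by linarith
    moreover have "real (card ?S) \<le> sqrt N" by simp
    ultimately have "real N / 2 \<le> A N + real (card ?B) + sqrt N" by linarith
    moreover have "sqrt N = N * (1 / sqrt N)" by (simp add: real_div_sqrt)
    ultimately have "real N / 2 \<le> A N + N * f N"
      using elim(1) unfolding f_def distrib_left[of "real N" _ "1 / sqrt N"] by linarith
    then show ?case using elim(2) by (simp add: field_simps)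
  qed
  have upper: "A N / N \<le> 1 / 2 + 1 / (2 * real N)" if "N > 0" for N
  proof -
    have "card {k\<in>{1..N}. odd k \<and> k \<in> Cset (mfun k)} \<le> card {k\<in>{1..N}. odd k}"
      by (intro card_mono) auto
    then have "2 * A N \<le> N + 1" unfolding A_def card_odd by linarith
    then show ?thesis using that by (simp add: field_simps)
  qed
  have "(\<lambda>N. A N / N) \<longlonglongrightarrow> 1 / 2"
  proof (rule tendsto_sandwich)
    show "eventually (\<lambda>N. 1 / 2 - f N \<le> A N / N) sequentially" by (rule lower)
    show "eventually (\<lambda>N. A N / N \<le> 1 / 2 + 1 / (2 * real N)) sequentially"
      using eventually_gt_at_top[of 0] by eventually_elim (rule upper)
    have "f \<longlonglongrightarrow> 0" unfolding f_def by real_asymp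
    then show "(\<lambda>N. 1 / 2 - f N) \<longlonglongrightarrow> 1 / 2" using tendsto_diff[OF tendsto_const] by fastforce
    show "(\<lambda>N. 1 / 2 + 1 / (2 * real N)) \<longlonglongrightarrow> 1 / 2" by real_asymp
  qed
  then show ?thesis unfolding A_def .
qed

end
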